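(* Let $n,p\in\mathbb N$, $a\in\mathbb C$, $a\neq 0$, $c\in\mathbb R$, and let an $n\times n$ matrix $A\in\mathbb C^{n\times n}$ be given. Put $v(x)=a\,e^{2\mathrm i c x}I_p$. (i) Assume additionally that $\det\big((A-cI_n)^2-|a|^2I_n\big)\neq 0$. Choose $Q\in\mathbb C^{n\times n}$ with $AQ=QA$ and $Q^2=(A-cI_n)^2-|a|^2I_n$. Let $f_1,f_2\in\mathbb C^{n\times p}$, $f_3=\frac1{\bar a}(Q+A-cI_n)f_1$, $f_4=-\frac1{\bar a}(Q-A+cI_n)f_2$, and $$\Lambda_1(x)=e^{-\mathrm i c x}\big(e^{\mathrm i xQ}f_1+e^{-\mathrm i xQ}f_2\big),\qquad \Lambda_2(x)=e^{\mathrm i c x}\big(e^{\mathrm i xQ}f_3+e^{-\mathrm i xQ}f_4\big),\qquad \Pi(x)=\begin{bmatrix}\Lambda_1(x)&\Lambda_2(x)\end{bmatrix}.$$ Let $S(0)=S(0)^*\in\mathbb C^{n\times n}$ satisfy $AS(0)-S(0)A^*=\mathrm i\,\Pi(0)j\Pi(0)^*$, put $S(x)=S(0)+\int_0^x\Pi(r)\Pi(r)^*dr$, and (at the points $x$ where $S(x)$ is invertible) put $$w_A(x,z)=I_{2p}-\mathrm i\,j\,\Pi(x)^*S(x)^{-1}(A-zI_n)^{-1}\Pi(x).$$ Then a fundamental solution $\widetilde u(x,z)$ of the self-adjoint Dirac system $$y'(x,z)=\mathrm i\big(zj+j\widetilde V(x)\big)y(x,z),\qquad \widetilde V=\begin{bmatrix}0&\widetilde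 v\\ \widetilde v^*&0\end{bmatrix},\quad \widetilde v(x)=v(x)-2\mathrm i\,\Lambda_1(x)^*S(x)^{-1}\Lambda_2(x),$$ has the form $\widetilde u(x,z)=w_A(x,z)u(x,z)$. Here $u(x,z)$ is a fundamental solution of the initial system $y'=\mathrm i(zj+jV(x))y$, $V=\begin{bmatrix}0&v\\ v^*&0\end{bmatrix}$, and may be presented in the form $$u(x,z)=e^{\mathrm i c x j}Z(z)e^{\mathrm i x\zeta(z) j},\quad \zeta(z)=\sqrt{(z-c)^2-|a|^2},\quad Z(z)=\begin{bmatrix}aI_p&aI_p\\(\zeta(z)-z+c)I_p&(-\zeta(z)-z+c)I_p\end{bmatrix}$$ (with either value of the square root). (ii) Assume that $\det\big((A-cI_n)^2+|a|^2I_n\big)\neq 0$. Choose $Q\in\mathbb C^{n\times n}$ with $AQ=QA$ and $Q^2=(A-cI_n)^2+|a|^2I_n$. Let $f_1,f_2\in\mathbb C^{n\times p}$, $f_3=\frac{\mathrm i}{\bar a}(Q+A-cI_n)f_1$, $f_4=-\frac{\mathrm i}{\bar a}(Q-A+cI_n)f_2$, and define $\Lambda_1,\Lambda_2,\Pi$ by the same formulas as in (i) in terms of $Q,f_1,\dots,f_4$. Let $S(0)=S(0)^*\in\mathbb C^{n\times n}$ satisfy $AS(0)-S(0)A^*=\mathrm i\,\Pi(0)\Pi(0)^*$, put $S(x)=S(0)+\int_0^x\Pi(r)j\Pi(r)^*dr$, and (at the points $x$ where $S(x)$ is invertible) put $$w_A(x,z)=I_{2p}-\mathrm i\,\Pi(x)^*S(x)^{-1}(A-zI_n)^{-1}\Pi(x).$$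 Then a fundamental solution $\widetilde u(x,z)$ of the skew-self-adjoint Dirac system $$y'(x,z)=\big(\mathrm i zj+j\widetilde V(x)\big)y(x,z),\qquad \widetilde V=\begin{bmatrix}0&\widetilde v\\ \widetilde v^*&0\end{bmatrix},\quad \widetilde v(x)=v(x)+2\Lambda_1(x)^*S(x)^{-1}\Lambda_2(x),$$ has the form $\widetilde u(x,z)=w_A(x,z)u(x,z)$. Here $u(x,z)$ is a fundamental solution of the initial system $y'=(\mathrm i zj+jV(x))y$, $V=\begin{bmatrix}0&v\\ v^*&0\end{bmatrix}$, and may be presented in the form $$u(x,z)=e^{\mathrm i c x j}Z(z)e^{\mathrm i x\zeta(z) j},\quad \zeta(z)=\sqrt{(z-c)^2+|a|^2},\quad Z(z)=\begin{bmatrix}\mathrm i aI_p&\mathrm i aI_p\\(z-c-\zeta(z))I_p&(z-c+\zeta(z))I_p\end{bmatrix}$$ (with either value of the square root).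
   Context: Here $\mathrm i^2=-1$, $j=\begin{bmatrix}I_p&0\\0&-I_p\end{bmatrix}$, $y'=\frac{\partial}{\partial x}y$, $A^*$ is the conjugate transpose of $A$, and $z$ is the complex spectral parameter. The Dirac systems are considered for $x$ in an interval of the real axis containing $0$; $w_A$ and $\widetilde V$ are considered where $S(x)$ is invertible. "Fundamental solution" is used in the usual sense of a $2p\times 2p$ fundamental matrix solution of the first-order linear system.
   Formalization: w_A u is claimed fundamental only for z not an eigenvalue of A or A* (its determinant is det(A*-z)/det(A-z) times det u), and the explicit u only for ζ(z)≠0 (otherwise Z(z) is singular); for ζ(z)=0, or z an eigenvalue of A* but not A, they are still shown to be matrix solutions. *)

theory Defs
  imports "HOL-Analysis.Analysis"
begin

subsection \<open>Complex matrices\<close>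

definition cscale :: "complex \<Rightarrow> complex^'n^'m \<Rightarrow> complex^'n^'m"  (infixr "*\<^sub>C" 75)
  where "z *\<^sub>C M = (\<chi> i k. z * M $ i $ k)"

definition ctrans :: "complex^'n^'m \<Rightarrow> complex^'m^'n"
  where "ctrans M = (\<chi> i k. cnj (M $ k $ i))"

text \<open>The type \<open>complex^'n^'n\<close> is not a Banach algebra for the matrix product, so the
  library's \<open>exp\<close> does not apply to it.\<close>

definition mexp :: "complex^'n^'n \<Rightarrow> complex^'n^'n"
  where "mexp M = (\<Sum>k. (1 / fact k) *\<^sub>R (((**) M ^^ k) (mat 1)))"

text \<open>The index set \<open>{1, \<dots>, 2p}\<close> is rendered as the sum type \<open>'p + 'p\<close>.\<close>

definition beside :: "complex^'p^'n \<Rightarrow> complex^'q^'n \<Rightarrow> complex^('p::finite + 'q::finite)^'n"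
  where "beside M N = (\<chi> i k. case k of Inl l \<Rightarrow> M $ i $ l | Inr l \<Rightarrow> N $ i $ l)"

definition block2 ::
    "complex^'p^'p \<Rightarrow> complex^'p^'p \<Rightarrow> complex^'p^'p \<Rightarrow> complex^'p^'p
      \<Rightarrow> complex^('p::finite + 'p)^('p::finite + 'p)"
  where "block2 M11 M12 M21 M22 =
    (\<chi> i k. case i of
        Inl i' \<Rightarrow> (case k of Inl k' \<Rightarrow> M11 $ i' $ k' | Inr k' \<Rightarrow> M12 $ i' $ k')
      | Inr i' \<Rightarrow> (case k of Inl k' \<Rightarrow> M21 $ i' $ k' | Inr k' \<Rightarrow> M22 $ i' $ k'))"

definition jmat :: "complex^('p::finite + 'p)^('p::finite + 'p)"
  where "jmat = block2 (mat 1) 0 0 (- mat 1)"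

definition Vmat :: "complex^'p^'p \<Rightarrow> complex^('p::finite + 'p)^('p::finite + 'p)"
  where "Vmat v = block2 0 v (ctrans v) 0"


subsection \<open>Linear systems and Dirac systems\<close>

text \<open>At endpoints of \<open>J\<close> that belong to \<open>J\<close> the derivative is one-sided.\<close>

definition matrix_solution_on ::
    "real set \<Rightarrow> (real \<Rightarrow> complex^'m^'m) \<Rightarrow> (real \<Rightarrow> complex^'m^'m) \<Rightarrow> bool"
  where "matrix_solution_on J F y \<longleftrightarrow>
    (\<forall>x\<in>J. (y has_vector_derivative F x ** y x) (at x within J))"

definition fundamental_solution_on ::
    "real set \<Rightarrow> (real \<Rightarrow> complex^'m^'m) \<Rightarrow> (real \<Rightarrow> complex^'m^'m) \<Rightarrow> bool"
  where "fundamental_solution_on J F y \<longleftrightarrow>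
    matrix_solution_on J F y \<and> (\<forall>x\<in>J. invertible (y x))"

definition sa_dirac ::
    "(real \<Rightarrow> complex^'p^'p) \<Rightarrow> complex \<Rightarrow> real \<Rightarrow> complex^('p::finite + 'p)^('p::finite + 'p)"
  where "sa_dirac v z x = \<i> *\<^sub>C (z *\<^sub>C jmat + jmat ** Vmat (v x))"

definition ssa_dirac ::
    "(real \<Rightarrow> complex^'p^'p) \<Rightarrow> complex \<Rightarrow> real \<Rightarrow> complex^('p::finite + 'p)^('p::finite + 'p)"
  where "ssa_dirac v z x = (\<i> * z) *\<^sub>C jmat + jmat ** Vmat (v x)"


subsection \<open>The transformation\<close>

definition Lam1 ::
    "real \<Rightarrow> complex^'n^'n \<Rightarrow> complex^'p^'n \<Rightarrow> complex^'p^'n \<Rightarrow> real \<Rightarrow> complex^'p^'n"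
  where "Lam1 c Q f1 f2 x = exp (- (\<i> * of_real c * of_real x)) *\<^sub>C
    (mexp ((\<i> * of_real x) *\<^sub>C Q) ** f1 + mexp ((- \<i> * of_real x) *\<^sub>C Q) ** f2)"

definition Lam2 ::
    "real \<Rightarrow> complex^'n^'n \<Rightarrow> complex^'p^'n \<Rightarrow> complex^'p^'n \<Rightarrow> real \<Rightarrow> complex^'p^'n"
  where "Lam2 c Q f3 f4 x = exp (\<i> * of_real c * of_real x) *\<^sub>C
    (mexp ((\<i> * of_real x) *\<^sub>C Q) ** f3 + mexp ((- \<i> * of_real x) *\<^sub>C Q) ** f4)"

text \<open>The interval integral is signed, so these formulas are also the intended ones for
  \<open>x < 0\<close>.\<close>

definition S_sa ::
    "complex^'n^'n \<Rightarrow> (real \<Rightarrow> complex^('p::finite + 'p)^'n) \<Rightarrow> real \<Rightarrow> complex^'n^'n"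
  where "S_sa S0 P x = S0 + (LBINT r=ereal 0..ereal x. P r ** ctrans (P r))"

definition S_ssa ::
    "complex^'n^'n \<Rightarrow> (real \<Rightarrow> complex^('p::finite + 'p)^'n) \<Rightarrow> real \<Rightarrow> complex^'n^'n"
  where "S_ssa S0 P x = S0 + (LBINT r=ereal 0..ereal x. P r ** jmat ** ctrans (P r))"

definition w_sa ::
    "complex^'n^'n \<Rightarrow> (real \<Rightarrow> complex^('p::finite + 'p)^'n) \<Rightarrow> (real \<Rightarrow> complex^'n^'n)
      \<Rightarrow> real \<Rightarrow> complex \<Rightarrow> complex^('p::finite + 'p)^('p::finite + 'p)"
  where "w_sa A P S x z = mat 1 - \<i> *\<^sub>C
    (jmat ** ctrans (P x) ** matrix_inv (S x) ** matrix_inv (A - mat z) ** P x)"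

definition w_ssa ::
    "complex^'n^'n \<Rightarrow> (real \<Rightarrow> complex^('p::finite + 'p)^'n) \<Rightarrow> (real \<Rightarrow> complex^'n^'n)
      \<Rightarrow> real \<Rightarrow> complex \<Rightarrow> complex^('p::finite + 'p)^('p::finite + 'p)"
  where "w_ssa A P S x z = mat 1 - \<i> *\<^sub>C
    (ctrans (P x) ** matrix_inv (S x) ** matrix_inv (A - mat z) ** P x)"


subsection \<open>Explicit solutions of the initial systems\<close>

definition Z_sa :: "complex \<Rightarrow> real \<Rightarrow> complex \<Rightarrow> complex \<Rightarrow> complex^('p::finite + 'p)^('p::finite + 'p)"
  where "Z_sa a c z \<zeta> = block2 (mat a) (mat a)
    (mat (\<zeta> - z + of_real c)) (mat (- \<zeta> - z + of_real c))"

definition Z_ssa :: "complex \<Rightarrow> real \<Rightarrow> complex \<Rightarrow> complex \<Rightarrow> complex^('p::finite + 'p)^('p::finite + 'p)"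
  where "Z_ssa a c z \<zeta> = block2 (mat (\<i> * a)) (mat (\<i> * a))
    (mat (z - of_real c - \<zeta>)) (mat (z - of_real c + \<zeta>))"

definition u_explicit ::
    "real \<Rightarrow> complex \<Rightarrow> complex^('p::finite + 'p)^('p::finite + 'p) \<Rightarrow> real \<Rightarrow> complex^('p::finite + 'p)^('p::finite + 'p)"
  where "u_explicit c \<zeta> Z x =
    mexp ((\<i> * of_real c * of_real x) *\<^sub>C jmat) ** Z ** mexp ((\<i> * of_real x * \<zeta>) *\<^sub>C jmat)"

end

theory Submission
  imports Defs
begin

text \<open>With \<open>K = j\<close> in the self-adjoint and \<open>K = 1\<close> in the skew-self-adjoint case, both initial systems
  read \<open>y' = (\<i> z j + N) y\<close> with \<open>K N\<^sup>* = - N K\<close>, and the relations between \<open>Q\<close> and the \<open>f\<^sub>i\<close> amount to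
  \<open>\<Pi>' = - \<i> A \<Pi> j - \<Pi> N\<close>. Since \<open>S' = \<Pi> K j \<Pi>\<^sup>*\<close>, the identity \<open>A S - S A\<^sup>* = \<i> \<Pi> K \<Pi>\<^sup>*\<close> propagates from
  \<open>x = 0\<close> to all \<open>x\<close>, and differentiating \<open>w = 1 - \<i> K \<Pi>\<^sup>* S\<^sup>-\<^sup>1 (A - z)\<^sup>-\<^sup>1 \<Pi>\<close> gives \<open>w' = (F + D) w - w F\<close> with
  \<open>F = \<i> z j + N\<close>, \<open>D = j K X - K X j\<close> and \<open>X = \<Pi>\<^sup>* S\<^sup>-\<^sup>1 \<Pi>\<close>; only the off-diagonal blocks of \<open>X\<close> contribute to
  \<open>D\<close>. The inverse of \<open>w\<close> is \<open>1 + \<i> K \<Pi>\<^sup>* (A\<^sup>* - z)\<^sup>-\<^sup>1 S\<^sup>-\<^sup>1 \<Pi>\<close>.\<close>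


subsection \<open>Complex matrices and their exponential\<close>

lemma cscale_nth [simp]: "(z *\<^sub>C M) $ i $ k = z * M $ i $ k"
  by (simp add: cscale_def)

lemma ctrans_nth [simp]: "ctrans M $ i $ k = cnj (M $ k $ i)"
  by (simp add: ctrans_def)

lemma cscale_algebra:
  "z *\<^sub>C (M + N) = z *\<^sub>C M + z *\<^sub>C N"
  "z *\<^sub>C (M - N) = z *\<^sub>C M - z *\<^sub>C N"
  "z *\<^sub>C (- M) = - (z *\<^sub>C M)"
  "(z + w) *\<^sub>C M = z *\<^sub>C M + w *\<^sub>C M"
  "(z - w) *\<^sub>C M = z *\<^sub>C M - w *\<^sub>C M"
  "(- z) *\<^sub>C M = - (z *\<^sub>C M)"
  "z *\<^sub>C w *\<^sub>C M = (z * w) *\<^sub>C M"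
  "z *\<^sub>C 0 = 0" "0 *\<^sub>C M = 0" "1 *\<^sub>C M = M"
  by (simp_all add: vec_eq_iff algebra_simps)

lemma matrix_mult_cscale:
  fixes M :: "complex^'m^'n" and N :: "complex^'k^'m"
  shows "(z *\<^sub>C M) ** N = z *\<^sub>C (M ** N)" "M ** (z *\<^sub>C N) = z *\<^sub>C (M ** N)"
  by (simp_all add: vec_eq_iff matrix_matrix_mult_def sum_distrib_left algebra_simps)

lemma matrix_mult_ring:
  fixes M M' :: "complex^'m^'n" and N N' :: "complex^'k^'m"
  shows "(M + M') ** N = M ** N + M' ** N" "M ** (N + N') = M ** N + M ** N'"
    "(M - M') ** N = M ** N - M' ** N" "M ** (N - N') = M ** N - M ** N'"
    "(- M) ** N = - (M ** N)" "M ** (- N) = - (M ** N)"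
  by (simp_all add: vec_eq_iff matrix_matrix_mult_def sum.distrib sum_subtractf sum_negf
      algebra_simps)

lemma ctrans_algebra:
  fixes M :: "complex^'m^'n" and N :: "complex^'k^'m"
  shows "ctrans (M ** N) = ctrans N ** ctrans M"
    "ctrans (K + L) = ctrans K + ctrans L" "ctrans (K - L) = ctrans K - ctrans L"
    "ctrans (- L) = - ctrans L" "ctrans (z *\<^sub>C L) = cnj z *\<^sub>C ctrans L"
    "ctrans 0 = 0" "ctrans (ctrans L) = L" "ctrans (mat z) = mat (cnj z)"
  by (simp_all add: vec_eq_iff matrix_matrix_mult_def mat_def mult.commute if_distrib)

lemma mat_eq_cscale: "mat z = z *\<^sub>C mat 1"
  by (simp add: vec_eq_iff mat_def)

lemma mat_matrix_mult: "mat z ** M = z *\<^sub>C M" "M ** mat z = z *\<^sub>C M"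
  for M :: "complex^'m^'n"
  by (subst mat_eq_cscale, simp add: matrix_mult_cscale)+

lemma scaleR_eq_cscale: "r *\<^sub>R M = of_real r *\<^sub>C M" for M :: "complex^'m^'n"
  by (simp add: vec_eq_iff) (simp add: scaleR_conv_of_real [where 'a = complex])

lemma matrix_mult_scaleR:
  fixes M :: "complex^'m^'n" and N :: "complex^'k^'m"
  shows "(r *\<^sub>R M) ** N = r *\<^sub>R (M ** N)" "M ** (r *\<^sub>R N) = r *\<^sub>R (M ** N)"
  by (simp_all add: scaleR_eq_cscale matrix_mult_cscale)

lemma bounded_bilinear_matrix_mult:
  "bounded_bilinear ((**) :: complex^'m^'n \<Rightarrow> complex^'k^'m \<Rightarrow> complex^'k^'n)"
  unfolding bilinear_conv_bounded_bilinear [symmetric] bilinear_def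
  by (auto intro!: linearI simp: matrix_mult_ring matrix_mult_scaleR)

lemma bounded_bilinear_cscale:
  "bounded_bilinear ((*\<^sub>C) :: complex \<Rightarrow> complex^'m^'n \<Rightarrow> _)"
  unfolding bilinear_conv_bounded_bilinear [symmetric] bilinear_def
  by (auto intro!: linearI simp: cscale_algebra scaleR_eq_cscale scaleR_conv_of_real [where 'a = complex] mult.commute)

lemma bounded_linear_ctrans: "bounded_linear (ctrans :: complex^'m^'n \<Rightarrow> _)"
  unfolding linear_conv_bounded_linear [symmetric]
  by (auto intro!: linearI simp: ctrans_algebra scaleR_eq_cscale)

lemmas has_vector_derivative_matrix_mult =
  bounded_bilinear.has_vector_derivative [OF bounded_bilinear_matrix_mult]

lemmas has_vector_derivative_ctrans =
  bounded_linear.has_vector_derivative [OF bounded_linear_ctrans]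

lemmas has_vector_derivative_cscale =
  bounded_bilinear.has_vector_derivative [OF bounded_bilinear_cscale]

section \<open>Entrywise derivatives and sums of matrices\<close>

lemma has_vector_derivative_matrixI:
  fixes f :: "real \<Rightarrow> complex^'m^'n"
  assumes "\<And>i k. ((\<lambda>x. f x $ i $ k) has_vector_derivative f' $ i $ k) (at x within J)"
  shows "(f has_vector_derivative f') (at x within J)"
  unfolding has_vector_derivative_def has_derivative_within
proof (intro conjI vec_tendstoI)
  show "bounded_linear (\<lambda>t. t *\<^sub>R f')"
    by (rule bounded_linear_scaleR_left)
  fix i k
  show "((\<lambda>y. ((1 / norm (y - x)) *\<^sub>R (f y - (f x + (y - x) *\<^sub>R f'))) $ i $ k)
      \<longlongrightarrow> (0 :: complex^'m^'n) $ i $ k) (at x within J)"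
    using assms[of i k] by (simp add: has_vector_derivative_def has_derivative_within)
qed

lemma sums_matrixI:
  fixes f :: "nat \<Rightarrow> complex^'m^'n"
  assumes "\<And>i k. (\<lambda>n. f n $ i $ k) sums (l $ i $ k)"
  shows "f sums l"
  unfolding sums_def
proof (intro vec_tendstoI)
  fix i k
  show "(\<lambda>n. sum f {..<n} $ i $ k) \<longlonglongrightarrow> l $ i $ k"
    using assms by (simp add: sums_def)
qed

section \<open>Matrix powers and the exponential series\<close>

definition mpow :: "complex^'n^'n \<Rightarrow> nat \<Rightarrow> complex^'n^'n"
  where "mpow M k = ((**) M ^^ k) (mat 1)"

lemma mpow_simps [simp]: "mpow M 0 = mat 1" "mpow M (Suc k) = M ** mpow M k"
  by (simp_all add: mpow_def)

lemma mpow_cscale: "mpow (t *\<^sub>C M) k = t ^ k *\<^sub>C mpow M k"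
  by (induction k) (simp_all add: matrix_mult_cscale cscale_algebra mult.commute)

lemma mpow_commute: "M ** N = N ** M \<Longrightarrow> mpow M k ** N = N ** mpow M k"
proof (induction k)
  case (Suc k)
  then show ?case by (simp flip: matrix_mul_assoc) (simp add: matrix_mul_assoc)
qed simp

text \<open>Each product adds \<open>CARD('n)\<close> terms, each at most \<open>b\<close> times the
  previous bound. The row index is generalized in the induction because multiplication from the left
  mixes the rows of the lower power. Working with entries avoids a submultiplicative matrix norm and
  suffices for comparison with a scalar exponential series.\<close>

lemma norm_mpow_le:
  fixes M :: "complex^'n^'n"
  assumes "\<And>i k. norm (M $ i $ k) \<le> b"
  shows "norm (mpow M m $ i $ k) \<le> (real CARD('n) * b) ^ m"
proof (induction m arbitrary: i)
  case 0
  then show ?case by (simp add: mat_def)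
next
  case (Suc m)
  have b: "0 \<le> b" using assms[of i k] norm_ge_zero order_trans by blast
  have "norm (mpow M (Suc m) $ i $ k) \<le> (\<Sum>l\<in>UNIV. norm (M $ i $ l * mpow M m $ l $ k))"
    by (simp add: matrix_matrix_mult_def norm_sum)
  also have "\<dots> \<le> (\<Sum>l\<in>(UNIV :: 'n set). b * (real CARD('n) * b) ^ m)"
    by (intro sum_mono) (simp add: norm_mult mult_mono assms b Suc)
  finally show ?case by (simp add: mult.assoc)
qed

lemma summable_mpow:
  fixes M :: "complex^'n^'n"
  shows "summable (\<lambda>m. (mpow M m $ i $ k / fact m) * t ^ m)"
proof -
  define b where "b = Max (range (\<lambda>(i, k). norm (M $ i $ k)))"
  have b: "norm (M $ i $ k) \<le> b" for i k
    unfolding b_def by (rule Max_ge) auto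
  have "summable (\<lambda>m. inverse (fact m) * (real CARD('n) * b * norm t) ^ m)"
    by (rule summable_exp)
  then show ?thesis
  proof (rule summable_comparison_test')
    fix m
    have "norm (mpow M m $ i $ k) / fact m * norm t ^ m \<le> (real CARD('n) * b) ^ m / fact m * norm t ^ m"
      by (intro mult_right_mono divide_right_mono norm_mpow_le[OF b]) auto
    then show "norm ((mpow M m $ i $ k / fact m) * t ^ m) \<le>
        inverse (fact m) * (real CARD('n) * b * norm t) ^ m"
      by (simp add: norm_mult norm_divide norm_power power_mult_distrib divide_simps mult_ac)
  qed
qed

lemma mexp_sums: "(\<lambda>m. (1 / fact m) *\<^sub>R mpow M m) sums mexp M"
proof -
  have "(\<lambda>m. (1 / fact m) *\<^sub>R mpow M m) sums (\<chi> i k. \<Sum>m. mpow M m $ i $ k / fact m)"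
    using summable_mpow[of M _ _ 1]
    by (intro sums_matrixI) (simp add: summable_sums scaleR_conv_of_real [where 'a = complex])
  then have "summable (\<lambda>m. (1 / fact m) *\<^sub>R mpow M m)" by (rule sums_summable)
  then show ?thesis by (simp add: mexp_def mpow_def summable_sums)
qed

lemma mexp_nth_sums:
  fixes M :: "complex^'n^'n"
  shows "(\<lambda>m. mpow M m $ i $ k / fact m * t ^ m) sums (mexp (t *\<^sub>C M) $ i $ k)"
proof -
  have "bounded_linear (\<lambda>M :: complex^'n^'n. M $ i $ k)"
    by (intro bounded_linear_compose[OF bounded_linear_vec_nth] bounded_linear_vec_nth)
  from bounded_linear.sums[OF this mexp_sums[of "t *\<^sub>C M"]] show ?thesis
    by (simp add: mpow_cscale scaleR_conv_of_real [where 'a = complex] mult.commute)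
qed

lemma mexp_commute:
  assumes "M ** N = N ** M"
  shows "mexp M ** N = N ** mexp M"
proof -
  have "(\<lambda>m. ((1 / fact m) *\<^sub>R mpow M m) ** N) sums (mexp M ** N)"
    by (rule bounded_linear.sums[OF bounded_bilinear.bounded_linear_left
          [OF bounded_bilinear_matrix_mult] mexp_sums])
  moreover have "(\<lambda>m. N ** ((1 / fact m) *\<^sub>R mpow M m)) sums (N ** mexp M)"
    by (rule bounded_linear.sums[OF bounded_bilinear.bounded_linear_right
          [OF bounded_bilinear_matrix_mult] mexp_sums])
  ultimately show ?thesis
    using sums_unique2 by (simp add: matrix_mult_scaleR mpow_commute[OF assms])
qed

text \<open>Every entry of the exponential of \<open>t\<close> times \<open>M\<close> is an
  everywhere convergent power series in a complex \<open>t\<close>, so scalar termwise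
  differentiation applies. The chain rule along the real curve \<open>w * of_real x\<close> then
  gives the claim.\<close>

lemma has_vector_derivative_mexp:
  "((\<lambda>x. mexp ((w * of_real x) *\<^sub>C M)) has_vector_derivative
      w *\<^sub>C (M ** mexp ((w * of_real x) *\<^sub>C M))) (at x within J)"
proof (rule has_vector_derivative_matrixI)
  fix i k
  define c where "c = (\<lambda>m. mpow M m $ i $ k / fact m)"
  have c: "mexp (t *\<^sub>C M) $ i $ k = (\<Sum>m. c m * t ^ m)" for t
    using sums_unique[OF mexp_nth_sums[of M i k t]] by (simp add: c_def)
  \<comment> \<open>The formal derivative has coefficients \<open>(m + 1) * c (m + 1)\<close>. The
    factor cancels against the factorial and leaves an entry of \<open>M ** mpow M m\<close> over
    \<open>fact m\<close>.\<close>
  have d: "(M ** mexp (t *\<^sub>C M)) $ i $ k = (\<Sum>m. diffs c m * t ^ m)" for t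
  proof -
    have "(\<lambda>m. \<Sum>l\<in>UNIV. M $ i $ l * (mpow M m $ l $ k / fact m * t ^ m)) sums
        (\<Sum>l\<in>UNIV. M $ i $ l * mexp (t *\<^sub>C M) $ l $ k)"
      by (intro sums_sum sums_mult mexp_nth_sums)
    also have "(\<lambda>m. \<Sum>l\<in>UNIV. M $ i $ l * (mpow M m $ l $ k / fact m * t ^ m)) =
        (\<lambda>m. diffs c m * t ^ m)"
      by (auto simp: diffs_def c_def matrix_matrix_mult_def sum_distrib_left sum_distrib_right
          sum_divide_distrib field_simps simp del: of_nat_Suc intro!: sum.cong)
    finally show ?thesis by (simp add: sums_iff matrix_matrix_mult_def)
  qed
  have "((\<lambda>t. mexp (t *\<^sub>C M) $ i $ k) has_field_derivative
      (M ** mexp ((w * of_real x) *\<^sub>C M)) $ i $ k) (at (w * of_real x))"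
    unfolding c d by (rule termdiffs_strong_converges_everywhere)
      (use summable_mpow[of M i k] in \<open>simp add: c_def\<close>)
  moreover have "((\<lambda>x. w * of_real x) has_vector_derivative w) (at x within J)"
    by (auto intro!: derivative_eq_intros)
  ultimately show "((\<lambda>x. mexp ((w * of_real x) *\<^sub>C M) $ i $ k) has_vector_derivative
      (w *\<^sub>C (M ** mexp ((w * of_real x) *\<^sub>C M))) $ i $ k) (at x within J)"
    using field_vector_diff_chain_within
        [where f = "\<lambda>x. w * of_real x" and g = "\<lambda>t. mexp (t *\<^sub>C M) $ i $ k" and S = J and x = x]
    by (simp add: o_def DERIV_subset[OF _ subset_UNIV])
qed


subsection \<open>Differentiating the matrix inverse\<close>

text \<open>The definition divides the remainder by \<open>norm (y - x)\<close>. The signed quotient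
  differs from that only by a sign, which is invisible to convergence in norm to zero.\<close>

lemma has_vector_derivative_iff_quotient:
  fixes f :: "real \<Rightarrow> 'a::real_normed_vector"
  shows "(f has_vector_derivative f') (at x within J) \<longleftrightarrow>
    ((\<lambda>y. (1 / (y - x)) *\<^sub>R (f y - f x)) \<longlongrightarrow> f') (at x within J)"
proof -
  have "norm ((1 / norm (y - x)) *\<^sub>R (f y - (f x + (y - x) *\<^sub>R f'))) =
      norm ((1 / (y - x)) *\<^sub>R (f y - f x) - f')" if "y \<noteq> x" for y
  proof -
    have "(1 / (y - x)) *\<^sub>R ((y - x) *\<^sub>R f') = f'"
      using that by simp
    then have "(1 / (y - x)) *\<^sub>R (f y - (f x + (y - x) *\<^sub>R f')) =
        (1 / (y - x)) *\<^sub>R (f y - f x) - f'"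
      by (simp only: diff_diff_eq [symmetric] scaleR_diff_right)
    moreover have "norm ((1 / norm (y - x)) *\<^sub>R v) = norm ((1 / (y - x)) *\<^sub>R v)" for v :: 'a
      by (simp only: norm_scaleR) simp
    ultimately show ?thesis by (simp only:)
  qed
  then have "((\<lambda>y. norm ((1 / norm (y - x)) *\<^sub>R (f y - (f x + (y - x) *\<^sub>R f')))) \<longlongrightarrow> 0) (at x within J)
      \<longleftrightarrow> ((\<lambda>y. norm ((1 / (y - x)) *\<^sub>R (f y - f x) - f')) \<longlongrightarrow> 0) (at x within J)"
    by (intro filterlim_cong refl) (auto simp: eventually_at_filter)
  then show ?thesis
    unfolding has_vector_derivative_def has_derivative_within tendsto_norm_zero_iff
    by (simp only: LIM_zero_iff bounded_linear_scaleR_left simp_thms)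
qed

lemma matrix_inv_mult:
  assumes "invertible M"
  shows "M ** matrix_inv M = mat 1" "matrix_inv M ** M = mat 1"
  using someI_ex[OF assms[unfolded invertible_def]] by (auto simp: matrix_inv_def)

lemma tendsto_det:
  fixes f :: "'a \<Rightarrow> complex^'n^'n"
  assumes "(f \<longlongrightarrow> M) F"
  shows "((\<lambda>x. det (f x)) \<longlongrightarrow> det M) F"
  unfolding det_def by (intro tendsto_intros assms)

text \<open>Column \<open>k\<close> of the inverse solves the linear system with right-hand side the
  \<open>k\<close>-th unit vector. Cramer's rule thus presents the entries as quotients of
  determinants, from which continuity of the inverse is immediate.\<close>

lemma matrix_inv_nth_cramer:
  fixes M :: "complex^'n^'n"
  assumes "invertible M"
  shows "matrix_inv M $ i $ k =
    det (\<chi> r s. if s = i then axis k 1 $ r else M $ r $ s) / det M"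
proof -
  have "M *v column k (matrix_inv M) = axis k 1"
    using matrix_inv_mult(1)[OF assms]
    by (simp add: vec_eq_iff matrix_matrix_mult_def matrix_vector_mult_def column_def mat_def axis_def)
  then have "column k (matrix_inv M) =
      (\<chi> i. det (\<chi> r s. if s = i then axis k 1 $ r else M $ r $ s) / det M)"
    using assms by (subst (asm) cramer) (simp_all add: invertible_det_nz)
  then show ?thesis by (simp add: vec_eq_iff column_def)
qed

lemma tendsto_matrix_inv:
  fixes f :: "'a \<Rightarrow> complex^'n^'n"
  assumes f: "(f \<longlongrightarrow> M) F" and M: "invertible M" and inv: "\<forall>\<^sub>F x in F. invertible (f x)"
  shows "((\<lambda>x. matrix_inv (f x)) \<longlongrightarrow> matrix_inv M) F"
proof (intro vec_tendstoI)
  fix i k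
  let ?r = "\<lambda>M :: complex^'n^'n. (\<chi> r s. if s = i then axis k 1 $ r else M $ r $ s) :: complex^'n^'n"
  let ?c = "\<lambda>M. det (?r M) / det M"
  have "((\<lambda>x. ?r (f x)) \<longlongrightarrow> ?r M) F"
    by (intro vec_tendstoI) (auto intro!: tendsto_vec_nth f)
  then have "((\<lambda>x. ?c (f x)) \<longlongrightarrow> ?c M) F"
    using M by (intro tendsto_divide tendsto_det f) (simp_all add: invertible_det_nz)
  then show "((\<lambda>x. matrix_inv (f x) $ i $ k) \<longlongrightarrow> matrix_inv M $ i $ k) F"
    unfolding matrix_inv_nth_cramer[OF M]
    by (rule Lim_transform_eventually)
      (rule eventually_mono[OF inv], simp add: matrix_inv_nth_cramer)
qed

text \<open>The difference of two inverses factors as minus inverse at \<open>y\<close>, times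
  \<open>S y - S x\<close>, times inverse at \<open>x\<close>. Dividing by \<open>y - x\<close>
  reduces the claim to the quotient of \<open>S\<close> and the continuity of the inverse.\<close>

lemma has_vector_derivative_matrix_inv:
  fixes S :: "real \<Rightarrow> complex^'n^'n"
  assumes S: "(S has_vector_derivative S') (at x within J)"
    and inv: "\<And>y. y \<in> J \<Longrightarrow> invertible (S y)" and x: "x \<in> J"
  shows "((\<lambda>y. matrix_inv (S y)) has_vector_derivative
    - (matrix_inv (S x) ** S' ** matrix_inv (S x))) (at x within J)"
  unfolding has_vector_derivative_iff_quotient
proof (rule Lim_transform_eventually)
  have "(S \<longlongrightarrow> S x) (at x within J)"
    using has_vector_derivative_continuous[OF S] by (simp add: continuous_within)
  then have "((\<lambda>y. matrix_inv (S y)) \<longlongrightarrow> matrix_inv (S x)) (at x within J)"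
    using inv x by (intro tendsto_matrix_inv) (auto simp: eventually_at_filter)
  then show "((\<lambda>y. - (matrix_inv (S y) ** ((1 / (y - x)) *\<^sub>R (S y - S x)) ** matrix_inv (S x))) \<longlongrightarrow>
      - (matrix_inv (S x) ** S' ** matrix_inv (S x))) (at x within J)"
    using S unfolding has_vector_derivative_iff_quotient
    by (intro tendsto_minus bounded_bilinear.tendsto[OF bounded_bilinear_matrix_mult] tendsto_const)
  show "\<forall>\<^sub>F y in at x within J.
      - (matrix_inv (S y) ** ((1 / (y - x)) *\<^sub>R (S y - S x)) ** matrix_inv (S x)) =
      (1 / (y - x)) *\<^sub>R (matrix_inv (S y) - matrix_inv (S x))"
    unfolding eventually_at_filter
  proof (intro always_eventually allI impI)
    fix y assume "y \<in> J"
    have "matrix_inv (S y) ** (S y - S x) ** matrix_inv (S x) =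
        (matrix_inv (S y) ** S y) ** matrix_inv (S x) - matrix_inv (S y) ** (S x ** matrix_inv (S x))"
      by (simp only: matrix_mult_ring matrix_mul_assoc)
    also have "\<dots> = - (matrix_inv (S y) - matrix_inv (S x))"
      using inv[OF x] inv[OF \<open>y \<in> J\<close>] by (simp add: matrix_inv_mult)
    finally show "- (matrix_inv (S y) ** ((1 / (y - x)) *\<^sub>R (S y - S x)) ** matrix_inv (S x)) =
        (1 / (y - x)) *\<^sub>R (matrix_inv (S y) - matrix_inv (S x))"
      by (simp only: matrix_mult_scaleR scaleR_minus_right minus_minus)
  qed
qed


subsection \<open>The Darboux transformation\<close>

text \<open>Pure algebra at one point: \<open>P'\<close> and \<open>S'\<close> stand for the
  derivatives of \<open>P\<close> and \<open>S\<close>, \<open>T\<close> for the inverse of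
  \<open>S\<close>, \<open>R\<close> for the resolvent. The left side is the product rule for
  \<open>w\<close>, with \<open>- (T ** S' ** T)\<close> as derivative of \<open>T\<close>. The
  proof eliminates \<open>A\<close> and \<open>R\<close> until only \<open>X\<close>,
  \<open>Y\<close>, \<open>K\<close>, \<open>j\<close> and \<open>N\<close> remain.\<close>

lemma darboux_identity:
  fixes A S T R :: "complex^'n^'n" and P :: "complex^'m^'n" and K j N :: "complex^'m^'m"
  assumes S: "A ** S - S ** ctrans A = \<i> *\<^sub>C (P ** K ** ctrans P)"
    and T: "S ** T = mat 1" "T ** S = mat 1"
    and R: "(A - mat z) ** R = mat 1" "R ** (A - mat z) = mat 1"
    and K: "K ** K = mat 1" "K ** j = j ** K" and KN: "K ** ctrans N = - (N ** K)"
    and j: "ctrans j = j"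
  defines "X \<equiv> ctrans P ** T ** P"
    and "w \<equiv> mat 1 - \<i> *\<^sub>C (K ** ctrans P ** T ** R ** P)"
    and "F \<equiv> (\<i> * z) *\<^sub>C j + N"
    and "P' \<equiv> - (\<i> *\<^sub>C (A ** P ** j)) - P ** N"
    and "S' \<equiv> P ** K ** j ** ctrans P"
  shows "- (\<i> *\<^sub>C (K ** ctrans P' ** T ** R ** P - K ** ctrans P ** T ** S' ** T ** R ** P
        + K ** ctrans P ** T ** R ** P')) =
      (F + (j ** K ** X - K ** X ** j)) ** w - w ** F"
proof -
  define Q where "Q = ctrans P"
  \<comment> \<open>Sandwiching the identity for \<open>S\<close> between two copies of
    \<open>T\<close> yields a rule that moves \<open>ctrans A\<close> past \<open>T\<close> and
    turns it into \<open>A\<close>.\<close>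
  have "T ** (A ** S - S ** ctrans A) ** T = T ** A ** (S ** T) - (T ** S) ** ctrans A ** T"
    by (simp only: matrix_mult_ring matrix_mul_assoc)
  also have "\<dots> = T ** A - ctrans A ** T"
    by (simp add: T)
  finally have TT: "T ** (A ** S - S ** ctrans A) ** T = T ** A - ctrans A ** T" .
  have AT: "ctrans A ** T = T ** A - \<i> *\<^sub>C (T ** P ** K ** Q ** T)"
    using TT unfolding S by (simp add: Q_def matrix_mult_cscale matrix_mul_assoc algebra_simps)
  have AR: "A ** R = mat 1 + z *\<^sub>C R" "R ** A = mat 1 + z *\<^sub>C R"
    using R by (simp_all add: matrix_mult_ring mat_matrix_mult algebra_simps)
  define G where "G = Q ** T"
  define H where "H = R ** P"
  have P': "ctrans P' = \<i> *\<^sub>C (j ** Q ** ctrans A) - ctrans N ** Q"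
    by (simp add: P'_def Q_def ctrans_algebra j cscale_algebra matrix_mul_assoc)
  have X: "X = G ** P" by (simp add: X_def G_def Q_def)
  \<comment> \<open>This is the derivative of the left factor \<open>G\<close>, expressed through
    \<open>G\<close> itself. The only \<open>A\<close> left stands to the right of \<open>G\<close>,
    where it meets \<open>H\<close> and is absorbed by the resolvent relation.\<close>
  have G: "ctrans P' ** T - Q ** T ** S' ** T =
      \<i> *\<^sub>C (j ** G ** A) + j ** X ** K ** G - ctrans N ** G - X ** K ** j ** G"
  proof -
    have "ctrans P' ** T = \<i> *\<^sub>C (j ** Q ** (ctrans A ** T)) - ctrans N ** G"
      by (simp add: P' matrix_mult_ring matrix_mult_cscale matrix_mul_assoc G_def)
    also have "\<dots> = \<i> *\<^sub>C (j ** G ** A) + j ** X ** K ** G - ctrans N ** G"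
      by (simp add: AT matrix_mult_ring matrix_mult_cscale matrix_mul_assoc G_def X
          cscale_algebra)
    finally show ?thesis
      by (simp add: S'_def X G_def matrix_mul_assoc Q_def)
  qed
  have H: "R ** P' = - (\<i> *\<^sub>C (P ** j)) - (\<i> * z) *\<^sub>C (H ** j) - H ** N"
  proof -
    have "R ** P' = - (\<i> *\<^sub>C ((R ** A) ** P ** j)) - H ** N"
      by (simp add: P'_def H_def matrix_mult_ring matrix_mult_cscale matrix_mul_assoc)
    then show ?thesis
      by (simp add: AR matrix_mult_ring matrix_mult_cscale cscale_algebra H_def)
  qed
  have AH: "A ** H = P + z *\<^sub>C H"
    by (simp add: H_def matrix_mul_assoc AR) (simp add: matrix_mult_ring matrix_mult_cscale)
  define Y where "Y = G ** H"
  have GH: "G ** A ** H = X + z *\<^sub>C Y"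
    by (simp flip: matrix_mul_assoc add: AH) (simp add: matrix_mult_ring matrix_mult_cscale X Y_def)
  have w: "w = mat 1 - \<i> *\<^sub>C (K ** Y)"
    by (simp add: w_def Y_def G_def H_def Q_def matrix_mul_assoc)
  have "K ** ctrans P' ** T ** R ** P - K ** ctrans P ** T ** S' ** T ** R ** P
        + K ** ctrans P ** T ** R ** P'
      = K ** ((ctrans P' ** T - Q ** T ** S' ** T) ** H + G ** (R ** P'))"
    by (simp add: matrix_mult_ring matrix_mul_assoc G_def H_def Q_def)
  also have "(ctrans P' ** T - Q ** T ** S' ** T) ** H =
     \<i> *\<^sub>C (j ** (G ** A ** H)) + j ** X ** K ** Y - ctrans N ** Y - X ** K ** j ** Y"
    unfolding G Y_def by (simp add: matrix_mult_ring matrix_mult_cscale matrix_mul_assoc)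
  also have "G ** (R ** P') = - (\<i> *\<^sub>C (X ** j)) - (\<i> * z) *\<^sub>C (Y ** j) - Y ** N"
    unfolding H X Y_def by (simp add: matrix_mult_ring matrix_mult_cscale matrix_mul_assoc)
  finally have *: "K ** ctrans P' ** T ** R ** P - K ** ctrans P ** T ** S' ** T ** R ** P
        + K ** ctrans P ** T ** R ** P' =
     K ** (\<i> *\<^sub>C (j ** (X + z *\<^sub>C Y)) + j ** X ** K ** Y - ctrans N ** Y - X ** K ** j ** Y
      + (- (\<i> *\<^sub>C (X ** j)) - (\<i> * z) *\<^sub>C (Y ** j) - Y ** N))"
    by (simp only: GH)
  \<comment> \<open>From here on only \<open>K ** K = mat 1\<close>, commutation of \<open>K\<close>
    with \<open>j\<close>, and the relation \<open>KN\<close> are used. The last one turns the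
    adjoint of \<open>N\<close> back into \<open>N\<close>.\<close>
  have K': "M ** K ** K = M" "M ** K ** j = M ** j ** K" for M :: "complex^'m^'m"
    using K by (simp_all flip: matrix_mul_assoc)
  show ?thesis
    unfolding * w F_def
    by (simp add: matrix_mult_ring matrix_mult_cscale matrix_mul_assoc K K' KN cscale_algebra)
      (simp add: vec_eq_iff algebra_simps)
qed

text \<open>Rewriting \<open>\<i> *\<^sub>C (P ** K ** ctrans P)\<close> as
  \<open>(A - mat z) ** S - S ** (ctrans A - mat z)\<close> makes the product of the two correction
  terms telescope: between \<open>T ** R\<close> and \<open>G ** T\<close> it collapses to
  \<open>G ** T - T ** R\<close>. The quadratic term therefore cancels the linear ones.\<close>

lemma darboux_inverse:
  fixes A S T R G :: "complex^'n^'n" and P :: "complex^'m^'n" and K :: "complex^'m^'m"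
  assumes S: "A ** S - S ** ctrans A = \<i> *\<^sub>C (P ** K ** ctrans P)"
    and T: "S ** T = mat 1" "T ** S = mat 1"
    and R: "R ** (A - mat z) = mat 1" and G: "(ctrans A - mat z) ** G = mat 1"
  shows "(mat 1 - \<i> *\<^sub>C (K ** ctrans P ** T ** R ** P)) **
    (mat 1 + \<i> *\<^sub>C (K ** ctrans P ** G ** T ** P)) = mat 1"
proof -
  have "T ** R ** (P ** K ** ctrans P) ** G ** T =
      - (\<i> *\<^sub>C (T ** R ** (\<i> *\<^sub>C (P ** K ** ctrans P)) ** G ** T))"
    by (simp add: matrix_mult_cscale cscale_algebra)
  also have "\<i> *\<^sub>C (P ** K ** ctrans P) = (A - mat z) ** S - S ** (ctrans A - mat z)"
    unfolding S[symmetric] by (simp add: matrix_mult_ring mat_matrix_mult)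
  also have "T ** R ** ((A - mat z) ** S - S ** (ctrans A - mat z)) ** G ** T =
      T ** (R ** (A - mat z)) ** S ** G ** T - T ** R ** S ** ((ctrans A - mat z) ** G) ** T"
    by (simp only: matrix_mult_ring(3,4)[of _ "T ** R"] matrix_mult_ring(3,4) matrix_mul_assoc)
  also have "\<dots> = G ** T - T ** R"
    using T by (simp only: R G matrix_mul_rid) (simp flip: matrix_mul_assoc)
  finally have *: "T ** R ** P ** K ** ctrans P ** G ** T = - (\<i> *\<^sub>C (G ** T - T ** R))"
    by (simp add: matrix_mul_assoc)
  have "K ** ctrans P ** T ** R ** P ** K ** ctrans P ** G ** T ** P =
     K ** ctrans P ** (T ** R ** P ** K ** ctrans P ** G ** T) ** P"
    by (simp add: matrix_mul_assoc)
  also have "\<dots> = - (\<i> *\<^sub>C (K ** ctrans P ** G ** T ** P - K ** ctrans P ** T ** R ** P))"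
    unfolding * by (simp add: matrix_mult_ring matrix_mult_cscale cscale_algebra matrix_mul_assoc)
  finally show ?thesis
    by (simp add: matrix_mult_ring matrix_mult_cscale cscale_algebra matrix_mul_assoc)
qed

lemma ctrans_matrix_inv:
  assumes "invertible M" "ctrans M = M"
  shows "ctrans (matrix_inv M) = matrix_inv M"
proof -
  have "M ** ctrans (matrix_inv M) = ctrans (matrix_inv M ** M)"
    by (simp add: ctrans_algebra assms)
  also have "\<dots> = mat 1"
    by (simp add: matrix_inv_mult assms ctrans_algebra)
  finally have "M ** ctrans (matrix_inv M) = mat 1" .
  then have "matrix_inv M ** (M ** ctrans (matrix_inv M)) = matrix_inv M"
    by simp
  then show ?thesis
    by (simp add: matrix_mul_assoc matrix_inv_mult assms)
qed

section \<open>The Darboux transformation along the real line\<close>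

lemma constant_if_derivative_zero:
  fixes f :: "real \<Rightarrow> 'a::real_normed_vector"
  assumes "\<And>x. (f has_vector_derivative 0) (at x)"
  shows "f x = f y"
proof -
  obtain k where "\<And>x. f x = k"
    using has_vector_derivative_zero_constant[of UNIV f] assms by auto
  then show ?thesis by simp
qed

text \<open>Here \<open>S\<close> may be singular at some points. Symmetry and the operator identity
  spread from 0 over the whole line through derivatives, and invertibility enters only later, on a
  set \<open>J\<close>.\<close>

locale darboux =
  fixes A :: "complex^'n^'n" and K j :: "complex^'m^'m"
    and P :: "real \<Rightarrow> complex^'m^'n" and N :: "real \<Rightarrow> complex^'m^'m"
    and S :: "real \<Rightarrow> complex^'n^'n"
  assumes K: "ctrans K = K" "K ** K = mat 1" "K ** j = j ** K"
    and j: "ctrans j = j"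
    and N: "K ** ctrans (N x) = - (N x ** K)"
    and P: "(P has_vector_derivative - (\<i> *\<^sub>C (A ** P x ** j)) - P x ** N x) (at x)"
    and S: "(S has_vector_derivative P x ** K ** j ** ctrans (P x)) (at x)"
    and S_zero: "ctrans (S 0) = S 0"
      "A ** S 0 - S 0 ** ctrans A = \<i> *\<^sub>C (P 0 ** K ** ctrans (P 0))"
begin

text \<open>Products are normalized to be bracketed to the left, so a relation between adjacent
  factors is usable as a rewrite rule only with a leading factor \<open>M\<close>. The same holds
  for \<open>N_assoc\<close>.\<close>

lemma K_assoc: "M ** K ** K = M" "M ** K ** j = M ** j ** K" for M :: "complex^'m^'k"
  using K by (simp_all flip: matrix_mul_assoc)

lemma N_assoc: "M ** K ** ctrans (N x) = - (M ** N x ** K)" for M :: "complex^'m^'k"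
  using N by (simp flip: matrix_mul_assoc add: matrix_mult_ring)

text \<open>The derivative of \<open>S\<close> is self-adjoint because \<open>K\<close> and
  \<open>j\<close> are self-adjoint and commute. Hence the skew part of \<open>S\<close> is
  constant, and it vanishes at 0.\<close>

lemma ctrans_S: "ctrans (S x) = S x"
proof -
  have "((\<lambda>x. ctrans (S x) - S x) has_vector_derivative 0) (at x)" for x
    by (rule has_vector_derivative_eq_rhs, rule has_vector_derivative_diff
        [OF has_vector_derivative_ctrans[OF S] S])
      (simp add: ctrans_algebra K j matrix_mul_assoc K_assoc)
  from constant_if_derivative_zero[OF this, of x 0] show ?thesis
    by (simp add: S_zero)
qed

lemma P_ctrans:
  "((\<lambda>x. ctrans (P x)) has_vector_derivative
    \<i> *\<^sub>C (j ** ctrans (P x) ** ctrans A) - ctrans (N x) ** ctrans (P x)) (at x)"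
  by (rule has_vector_derivative_eq_rhs, rule has_vector_derivative_ctrans[OF P])
    (simp add: ctrans_algebra j cscale_algebra matrix_mul_assoc)

text \<open>The defect has derivative zero: the terms with \<open>A\<close> from both sides match
  since \<open>K\<close> and \<open>j\<close> commute, and the terms with \<open>N\<close> cancel by
  the relation between \<open>K\<close> and \<open>N\<close>.\<close>

lemma operator_identity: "A ** S x - S x ** ctrans A = \<i> *\<^sub>C (P x ** K ** ctrans (P x))"
proof -
  have "((\<lambda>x. A ** S x - S x ** ctrans A - \<i> *\<^sub>C (P x ** K ** ctrans (P x)))
      has_vector_derivative 0) (at x)" for x
    by (rule has_vector_derivative_eq_rhs, (rule has_vector_derivative_diff
        has_vector_derivative_matrix_mult[OF has_vector_derivative_const S]
        has_vector_derivative_matrix_mult[OF S has_vector_derivative_const]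
        has_vector_derivative_cscale[OF has_vector_derivative_const]
        has_vector_derivative_matrix_mult[OF _ P_ctrans]
        has_vector_derivative_matrix_mult[OF P has_vector_derivative_const])+)
      (simp add: matrix_mult_ring matrix_mult_cscale cscale_algebra matrix_mul_assoc K K_assoc
        N_assoc)
  from constant_if_derivative_zero[OF this, of x 0] show ?thesis
    by (simp add: S_zero)
qed

definition w :: "complex \<Rightarrow> real \<Rightarrow> complex^'m^'m"
  where "w z x = mat 1 - \<i> *\<^sub>C
    (K ** ctrans (P x) ** matrix_inv (S x) ** matrix_inv (A - mat z) ** P x)"

definition F :: "complex \<Rightarrow> real \<Rightarrow> complex^'m^'m"
  where "F z x = (\<i> * z) *\<^sub>C j + N x"

definition X :: "real \<Rightarrow> complex^'m^'m"
  where "X x = ctrans (P x) ** matrix_inv (S x) ** P x"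

lemma w_has_vector_derivative:
  assumes inv: "\<And>y. y \<in> J \<Longrightarrow> invertible (S y)" "invertible (A - mat z)" and x: "x \<in> J"
  shows "(w z has_vector_derivative
    (F z x + (j ** K ** X x - K ** X x ** j)) ** w z x - w z x ** F z x) (at x within J)"
proof -
  let ?P' = "- (\<i> *\<^sub>C (A ** P x ** j)) - P x ** N x"
  let ?S' = "P x ** K ** j ** ctrans (P x)"
  let ?T = "matrix_inv (S x)" and ?R = "matrix_inv (A - mat z)"
  have P': "(P has_vector_derivative ?P') (at x within J)"
    using P by (rule has_vector_derivative_at_within)
  have T': "((\<lambda>y. matrix_inv (S y)) has_vector_derivative - (?T ** ?S' ** ?T)) (at x within J)"
    by (rule has_vector_derivative_matrix_inv[OF has_vector_derivative_at_within[OF S] inv(1) x])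
  have "(w z has_vector_derivative
    - (\<i> *\<^sub>C (K ** ctrans ?P' ** ?T ** ?R ** P x - K ** ctrans (P x) ** ?T ** ?S' ** ?T ** ?R ** P x
        + K ** ctrans (P x) ** ?T ** ?R ** ?P'))) (at x within J)"
    unfolding w_def[abs_def]
    by (rule has_vector_derivative_eq_rhs, (rule has_vector_derivative_diff
        has_vector_derivative_const has_vector_derivative_cscale[OF has_vector_derivative_const]
        has_vector_derivative_matrix_mult[OF _ P']
        has_vector_derivative_matrix_mult[OF _ has_vector_derivative_const]
        has_vector_derivative_matrix_mult[OF _ T']
        has_vector_derivative_matrix_mult[OF has_vector_derivative_const
          has_vector_derivative_ctrans[OF P']])+)
      (simp add: matrix_mult_ring matrix_mul_assoc cscale_algebra algebra_simps)
  then show ?thesis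
    unfolding w_def F_def X_def
    by (subst (asm) darboux_identity[OF operator_identity _ _ _ _ K(2,3) N j, where z = z])
      (simp_all add: matrix_inv_mult inv x)
qed

text \<open>The trailing term \<open>w z x ** F z x\<close> in the derivative of \<open>w\<close> is
  exactly cancelled by differentiating \<open>u\<close>.\<close>

lemma matrix_solution:
  assumes inv: "\<And>y. y \<in> J \<Longrightarrow> invertible (S y)" "invertible (A - mat z)"
    and u: "matrix_solution_on J (F z) u"
  shows "matrix_solution_on J (\<lambda>x. F z x + (j ** K ** X x - K ** X x ** j)) (\<lambda>x. w z x ** u x)"
  unfolding matrix_solution_on_def
proof
  fix x assume x: "x \<in> J"
  show "((\<lambda>x. w z x ** u x) has_vector_derivative
      (F z x + (j ** K ** X x - K ** X x ** j)) ** (w z x ** u x)) (at x within J)"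
    by (rule has_vector_derivative_eq_rhs,
        rule has_vector_derivative_matrix_mult[OF w_has_vector_derivative[OF inv x]])
      (use u x in \<open>auto simp: matrix_solution_on_def matrix_mult_ring matrix_mul_assoc\<close>)
qed

text \<open>For square matrices the right inverse from \<open>darboux_inverse\<close> suffices. It
  contains the inverse of \<open>ctrans A - mat z\<close>, whence the third assumption; in fact the
  determinant of \<open>w z x\<close> is the quotient of those of \<open>ctrans A - mat z\<close>
  and \<open>A - mat z\<close>.\<close>

lemma invertible_w:
  assumes "invertible (S x)" "invertible (A - mat z)" "invertible (ctrans A - mat z)"
  shows "invertible (w z x)"
  using darboux_inverse[OF operator_identity matrix_inv_mult[OF assms(1)]
      matrix_inv_mult(2)[OF assms(2)] matrix_inv_mult(1)[OF assms(3)]]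
  unfolding w_def invertible_right_inverse by blast

lemma fundamental_solution:
  assumes inv: "\<And>y. y \<in> J \<Longrightarrow> invertible (S y)" "invertible (A - mat z)"
      "invertible (ctrans A - mat z)"
    and u: "fundamental_solution_on J (F z) u"
  shows "fundamental_solution_on J (\<lambda>x. F z x + (j ** K ** X x - K ** X x ** j)) (\<lambda>x. w z x ** u x)"
  using u matrix_solution[OF inv(1,2)] invertible_w[OF inv(1) inv(2,3)]
  by (auto simp: fundamental_solution_on_def invertible_mult)

end

lemma has_vector_derivative_interval_integral:
  fixes f :: "real \<Rightarrow> 'a::euclidean_space"
  assumes "continuous_on UNIV f"
  shows "((\<lambda>x. LBINT r=ereal 0..ereal x. f r) has_vector_derivative f x) (at x)"
proof -
  \<comment> \<open>A symmetric interval contains 0 and has \<open>x\<close> in its interior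
    whatever the sign of \<open>x\<close>, so the one-sided notion becomes the full
    derivative.\<close>
  let ?I = "{- \<bar>x\<bar> - 1..\<bar>x\<bar> + 1}"
  have "((\<lambda>x. LBINT r=ereal 0..ereal x. f r) has_vector_derivative f x) (at x within ?I)"
    using assms by (intro interval_integral_FTC2) (auto intro: continuous_on_subset)
  moreover have "x \<in> interior ?I" by auto
  ultimately show ?thesis by (simp only: at_within_interior)
qed


subsection \<open>Block matrices\<close>

lemma sum_UNIV_Plus:
  "(\<Sum>i\<in>UNIV. f i) = (\<Sum>i\<in>UNIV. f (Inl i)) + (\<Sum>i\<in>UNIV. f (Inr i))"
  for f :: "'p::finite + 'q::finite \<Rightarrow> 'a::comm_monoid_add"
  by (subst UNIV_Plus_UNIV [symmetric]) (simp add: sum.Plus o_def del: UNIV_Plus_UNIV)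

lemma block2_nth [simp]:
  "block2 a b c d $ Inl i $ Inl k = a $ i $ k" "block2 a b c d $ Inl i $ Inr k = b $ i $ k"
  "block2 a b c d $ Inr i $ Inl k = c $ i $ k" "block2 a b c d $ Inr i $ Inr k = d $ i $ k"
  by (simp_all add: block2_def)

lemma beside_nth [simp]:
  "beside M N $ i $ Inl k = M $ i $ k" "beside M N $ i $ Inr l = N $ i $ l"
  by (simp_all add: beside_def)

lemma block2_eqI:
  assumes "\<And>i k. M $ Inl i $ Inl k = M' $ Inl i $ Inl k" "\<And>i k. M $ Inl i $ Inr k = M' $ Inl i $ Inr k"
    "\<And>i k. M $ Inr i $ Inl k = M' $ Inr i $ Inl k" "\<And>i k. M $ Inr i $ Inr k = M' $ Inr i $ Inr k"
  shows "M = (M' :: complex^('p::finite + 'p)^('p + 'p))"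
  unfolding vec_eq_iff
proof (intro allI)
  fix i k show "M $ i $ k = M' $ i $ k" by (cases i; cases k) (simp_all add: assms)
qed

lemma beside_eqI:
  assumes "\<And>i k. M $ i $ Inl k = M' $ i $ Inl k" "\<And>i k. M $ i $ Inr k = M' $ i $ Inr k"
  shows "M = (M' :: complex^('p::finite + 'q::finite)^'n)"
  unfolding vec_eq_iff
proof (intro allI)
  fix i k show "M $ i $ k = M' $ i $ k" by (cases k) (simp_all add: assms)
qed

lemma block2_algebra:
  "block2 a b c d ** block2 a' b' c' d' =
    block2 (a ** a' + b ** c') (a ** b' + b ** d') (c ** a' + d ** c') (c ** b' + d ** d')"
  "block2 a b c d + block2 a' b' c' d' = block2 (a + a') (b + b') (c + c') (d + d')"
  "block2 a b c d - block2 a' b' c' d' = block2 (a - a') (b - b') (c - c') (d - d')"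
  "- block2 a b c d = block2 (- a) (- b) (- c) (- d)"
  "z *\<^sub>C block2 a b c d = block2 (z *\<^sub>C a) (z *\<^sub>C b) (z *\<^sub>C c) (z *\<^sub>C d)"
  "ctrans (block2 a b c d) = block2 (ctrans a) (ctrans c) (ctrans b) (ctrans d)"
  by (rule block2_eqI; simp add: matrix_matrix_mult_def sum_UNIV_Plus)+

lemma mat_eq_block2: "mat z = block2 (mat z) (mat 0) (mat 0) (mat z)"
  by (rule block2_eqI) (simp_all add: mat_def)

lemma beside_algebra:
  "beside M M' ** block2 a b c d = beside (M ** a + M' ** c) (M ** b + M' ** d)"
  "beside M M' + beside L L' = beside (M + L) (M' + L')"
  "beside M M' - beside L L' = beside (M - L) (M' - L')"
  "- beside M M' = beside (- M) (- M')"
  "z *\<^sub>C beside M M' = beside (z *\<^sub>C M) (z *\<^sub>C M')"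
  "A ** beside M M' = beside (A ** M) (A ** M')"
  by (rule beside_eqI; simp add: matrix_matrix_mult_def sum_UNIV_Plus)+

lemma ctrans_beside_sandwich:
  "ctrans (beside M M') ** T ** beside L L' =
    block2 (ctrans M ** T ** L) (ctrans M ** T ** L') (ctrans M' ** T ** L) (ctrans M' ** T ** L')"
  unfolding matrix_mul_assoc[symmetric] beside_algebra
  by (rule block2_eqI) (simp_all add: matrix_matrix_mult_def)

lemma mat_algebra:
  "z *\<^sub>C mat w = (mat (z * w) :: complex^'n^'n)" "mat z + mat w = (mat (z + w) :: complex^'n^'n)"
  "mat z - mat w = (mat (z - w) :: complex^'n^'n)" "- mat z = (mat (- z) :: complex^'n^'n)"
  "mat 0 = (0 :: complex^'n^'n)"
  by (simp_all add: vec_eq_iff mat_def)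

lemma has_vector_derivative_matrix_nth:
  fixes f :: "real \<Rightarrow> complex^'m^'n"
  assumes "(f has_vector_derivative f') F"
  shows "((\<lambda>x. f x $ i $ k) has_vector_derivative f' $ i $ k) F"
proof -
  have "bounded_linear (\<lambda>M :: complex^'m^'n. M $ i $ k)"
    by (intro bounded_linear_compose[OF bounded_linear_vec_nth] bounded_linear_vec_nth)
  from bounded_linear.has_vector_derivative[OF this assms] show ?thesis .
qed

lemma has_vector_derivative_beside:
  assumes "(f has_vector_derivative f') (at x within J)" "(g has_vector_derivative g') (at x within J)"
  shows "((\<lambda>x. beside (f x) (g x)) has_vector_derivative beside f' g') (at x within J)"
proof (rule has_vector_derivative_matrixI)
  fix i k
  show "((\<lambda>x. beside (f x) (g x) $ i $ k) has_vector_derivative beside f' g' $ i $ k) (at x within J)"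
    using assms by (cases k) (simp_all add: has_vector_derivative_matrix_nth)
qed

lemma has_vector_derivative_block2_mat:
  assumes "(p has_vector_derivative p') (at x within J)" "(q has_vector_derivative q') (at x within J)"
    "(r has_vector_derivative r') (at x within J)" "(s has_vector_derivative s') (at x within J)"
  shows "((\<lambda>x. block2 (mat (p x)) (mat (q x)) (mat (r x)) (mat (s x))) has_vector_derivative
    block2 (mat p') (mat q') (mat r') (mat s')) (at x within J)"
proof (rule has_vector_derivative_matrixI)
  fix i k :: "'a + 'a"
  show "((\<lambda>x. block2 (mat (p x)) (mat (q x)) (mat (r x)) (mat (s x)) $ i $ k) has_vector_derivative
    block2 (mat p') (mat q') (mat r') (mat s') $ i $ k) (at x within J)"
    using assms by (cases i; cases k) (auto simp: mat_def)
qed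

text \<open>Matrices whose blocks are scalar behave like 2 by 2 complex matrices. This rule reduces
  their equality to four complex equations; constant blocks are written \<open>mat 0\<close> and
  \<open>mat (- 1)\<close> elsewhere to fit the pattern.\<close>

lemma block2_mat_cong:
  assumes "p = p'" "q = q'" "r = r'" "s = s'"
  shows "block2 (mat p) (mat q) (mat r) (mat s) = block2 (mat p') (mat q') (mat r') (mat s')"
  using assms by simp

text \<open>Scalar blocks commute, so the adjugate of the 2 by 2 matrix divided by its determinant
  is an inverse.\<close>

lemma invertible_block2_mat:
  assumes "p * s - q * r \<noteq> 0"
  shows "invertible (block2 (mat p) (mat q) (mat r) (mat s) :: complex^('p::finite + 'p)^('p + 'p))"
proof -
  let ?d = "p * s - q * r"
  have "block2 (mat p) (mat q) (mat r) (mat s) **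
      block2 (mat (s / ?d)) (mat (- q / ?d)) (mat (- r / ?d)) (mat (p / ?d)) =
      (mat 1 :: complex^('p + 'p)^('p + 'p))"
    unfolding mat_eq_block2[of 1] block2_algebra mat_matrix_mult mat_algebra(1,2)
    using assms by (intro block2_mat_cong) (simp_all add: divide_simps)
  then show ?thesis unfolding invertible_right_inverse by blast
qed

lemma jmat_eq: "jmat = block2 (mat 1) (mat 0) (mat 0) (mat (- 1))"
  by (simp add: jmat_def mat_algebra)

lemma jmat_Vmat: "jmat ** Vmat M = block2 0 M (- ctrans M) 0"
  unfolding jmat_def Vmat_def block2_algebra by (simp add: matrix_mult_ring)

lemma jmat_simps: "ctrans jmat = jmat" "jmat ** jmat = mat 1"
  unfolding jmat_eq mat_eq_block2[of 1] block2_algebra mat_matrix_mult mat_algebra(1,2) ctrans_algebra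
  by simp_all

lemma has_vector_derivative_exp_linear:
  "((\<lambda>x. exp (w * of_real x)) has_vector_derivative w * exp (w * of_real x)) (at x within J)"
  for w :: complex
  by (rule has_vector_derivative_real_field) (auto intro!: derivative_eq_intros)

lemma mpow_jmat: "mpow jmat m = block2 (mat 1) (mat 0) (mat 0) (mat ((- 1) ^ m))"
proof (induction m)
  case 0
  then show ?case by (simp add: mat_eq_block2[of 1] mat_algebra)
next
  case (Suc m)
  show ?case
    unfolding mpow_simps Suc unfolding jmat_eq block2_algebra mat_matrix_mult mat_algebra(1,2) by simp
qed

lemma mexp_jmat: "mexp (t *\<^sub>C jmat) = block2 (mat (exp t)) (mat 0) (mat 0) (mat (exp (- t)))"
proof -
  have e: "(\<lambda>m. t ^ m / fact m) sums exp t" for t :: complex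
    using exp_converges[of t] by (simp add: scaleR_conv_of_real field_simps)
  have "mexp (t *\<^sub>C jmat) $ i $ k =
      block2 (mat (exp t)) (mat 0) (mat 0) (mat (exp (- t))) $ i $ k" for i k :: "'a + 'a"
    using mexp_nth_sums[of jmat i k t] e[of t] e[of "- t"] unfolding mpow_jmat
    by (cases i; cases k; cases "i = k")
      (auto simp: mat_def sums_iff power_minus[of t] mult.commute)
  then show ?thesis by (simp add: vec_eq_iff)
qed

text \<open>One statement for both \<open>Lam1\<close> and \<open>Lam2\<close>. Differentiation puts
  the left sides of \<open>f\<close> and \<open>g\<close> behind the two exponentials. Since
  \<open>A\<close> commutes with \<open>Q\<close>, it can be pulled out in front of them, and
  \<open>exp ((w - w') * of_real x)\<close> accounts for the different scalar prefactor of the other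
  function.\<close>

lemma has_vector_derivative_Lam:
  fixes A Q :: "complex^'n^'n" and f g f' g' :: "complex^'p^'n"
  defines "L \<equiv> \<lambda>w f g x. exp (w * of_real x) *\<^sub>C
      (mexp ((\<i> * of_real x) *\<^sub>C Q) ** f + mexp ((- \<i> * of_real x) *\<^sub>C Q) ** g)"
  assumes comm: "A ** Q = Q ** A"
    and f: "w *\<^sub>C f + \<i> *\<^sub>C (Q ** f) = \<alpha> *\<^sub>C (A ** f) + \<beta> *\<^sub>C f'"
    and g: "w *\<^sub>C g - \<i> *\<^sub>C (Q ** g) = \<alpha> *\<^sub>C (A ** g) + \<beta> *\<^sub>C g'"
  shows "(L w f g has_vector_derivative
    \<alpha> *\<^sub>C (A ** L w f g x) + (\<beta> * exp ((w - w') * of_real x)) *\<^sub>C L w' f' g' x) (at x within J)"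
proof -
  define E where "E = (\<lambda>s x. mexp ((s * of_real x) *\<^sub>C Q))"
  have E: "Q ** E s x = E s x ** Q" "A ** E s x = E s x ** A" for s x
    unfolding E_def using comm
    by (simp_all add: mexp_commute matrix_mult_cscale)
  have E': "(E s has_vector_derivative s *\<^sub>C (E s x ** Q)) (at x within J)" for s
    unfolding E(1)[symmetric] unfolding E_def by (rule has_vector_derivative_mexp)
  have "exp (w * of_real x) *\<^sub>C (E \<i> x ** (w *\<^sub>C f + \<i> *\<^sub>C (Q ** f)) + E (- \<i>) x ** (w *\<^sub>C g - \<i> *\<^sub>C (Q ** g))) =
    \<alpha> *\<^sub>C (A ** (exp (w * of_real x) *\<^sub>C (E \<i> x ** f + E (- \<i>) x ** g))) +
    (\<beta> * exp ((w - w') * of_real x)) *\<^sub>C exp (w' * of_real x) *\<^sub>C (E \<i> x ** f' + E (- \<i>) x ** g')"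
    unfolding f g
    by (simp add: matrix_mult_ring matrix_mult_cscale cscale_algebra matrix_mul_assoc E(2)
        mult.assoc flip: exp_add)
      (simp add: vec_eq_iff algebra_simps)
  moreover have "(L w f g has_vector_derivative exp (w * of_real x) *\<^sub>C
      (E \<i> x ** (w *\<^sub>C f + \<i> *\<^sub>C (Q ** f)) + E (- \<i>) x ** (w *\<^sub>C g - \<i> *\<^sub>C (Q ** g)))) (at x within J)"
    unfolding L_def E_def[symmetric, THEN fun_cong, THEN fun_cong]
    by (rule has_vector_derivative_eq_rhs,
        (rule has_vector_derivative_cscale[OF has_vector_derivative_exp_linear]
          has_vector_derivative_add
          has_vector_derivative_matrix_mult[OF E' has_vector_derivative_const])+)
      (simp add: matrix_mult_ring matrix_mult_cscale cscale_algebra matrix_mul_assoc algebra_simps)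
  ultimately show ?thesis unfolding L_def E_def by simp
qed


subsection \<open>Explicit solutions\<close>

lemma matrix_solution_on_block2_mat:
  assumes "\<And>x. (p has_vector_derivative \<alpha> x * p x + \<beta> x * r x) (at x)"
    "\<And>x. (q has_vector_derivative \<alpha> x * q x + \<beta> x * s x) (at x)"
    "\<And>x. (r has_vector_derivative \<gamma> x * p x + \<delta> x * r x) (at x)"
    "\<And>x. (s has_vector_derivative \<gamma> x * q x + \<delta> x * s x) (at x)"
  shows "matrix_solution_on UNIV
    (\<lambda>x. block2 (mat (\<alpha> x)) (mat (\<beta> x)) (mat (\<gamma> x)) (mat (\<delta> x)))
    (\<lambda>x. block2 (mat (p x)) (mat (q x)) (mat (r x)) (mat (s x)))"
  unfolding matrix_solution_on_def block2_algebra mat_matrix_mult mat_algebra(1,2)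
  using assms by (intro ballI has_vector_derivative_block2_mat) (simp_all add: mult.commute)

text \<open>A common form of both initial systems. The self-adjoint one has \<open>b * d\<close>
  equal to the squared modulus of \<open>a\<close>, the skew-self-adjoint one its negative; this is
  the origin of the two signs in the formula for \<zeta>.\<close>

definition periodic_system :: "complex \<Rightarrow> complex \<Rightarrow> real \<Rightarrow> complex \<Rightarrow> real \<Rightarrow> complex^('p::finite + 'p)^('p + 'p)"
  where "periodic_system b d c z x =
    block2 (mat (\<i> * z)) (mat (b * exp (2 * \<i> * of_real c * of_real x)))
      (mat (d * exp (- (2 * \<i> * of_real c * of_real x)))) (mat (- (\<i> * z)))"

lemma u_explicit_block2:
  "u_explicit c \<zeta> (block2 (mat z11) (mat z12) (mat z21) (mat z22)) x =
    block2 (mat (z11 * exp ((\<i> * (c + \<zeta>)) * of_real x))) (mat (z12 * exp ((\<i> * (c - \<zeta>)) * of_real x)))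
      (mat (z21 * exp ((\<i> * (\<zeta> - c)) * of_real x))) (mat (z22 * exp ((\<i> * (- \<zeta> - c)) * of_real x)))"
  unfolding u_explicit_def mexp_jmat block2_algebra mat_matrix_mult mat_algebra(1,2)
  by (intro block2_mat_cong)
    (simp_all add: algebra_simps flip: exp_add)

text \<open>Removing the factor \<open>exp (\<i> c x j)\<close> leaves a constant trace-free
  coefficient matrix whose square is minus \<zeta> squared. The columns of the middle factor are its
  eigenvectors for \<open>\<i> * \<zeta>\<close> and \<open>- \<i> * \<zeta>\<close>. The parameter
  \<open>k\<close> only normalizes them, to fit both \<open>Z_sa\<close> and
  \<open>Z_ssa\<close>.\<close>

lemma periodic_system_solution:
  fixes b d k z \<zeta> :: complex and c :: real
  assumes \<zeta>: "\<zeta>^2 = (z - of_real c)^2 - b * d"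
  defines "u \<equiv> u_explicit c \<zeta> (block2 (mat (k * (- \<i> * b))) (mat (k * (- \<i> * b)))
    (mat (k * (\<zeta> - (z - of_real c)))) (mat (k * (- \<zeta> - (z - of_real c)))))"
  shows "matrix_solution_on UNIV (periodic_system b d c z) u"
    and "k \<noteq> 0 \<Longrightarrow> b \<noteq> 0 \<Longrightarrow> \<zeta> \<noteq> 0 \<Longrightarrow> invertible (u x)"
proof -
  have bd: "b * d = (z - of_real c)^2 - \<zeta>^2" using \<zeta> by simp
  have e: "exp (2 * \<i> * of_real c * of_real x) * exp ((\<i> * (\<zeta> - of_real c)) * of_real x) =
      exp ((\<i> * (of_real c + \<zeta>)) * of_real x)"
    "exp (- (2 * \<i> * of_real c * of_real x)) * exp ((\<i> * (of_real c + \<zeta>)) * of_real x) =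
      exp ((\<i> * (\<zeta> - of_real c)) * of_real x)" for x and \<zeta> :: complex
    by (simp_all add: algebra_simps flip: exp_add)
  have exp': "((\<lambda>x. y * exp (\<omega> * of_real x)) has_vector_derivative
      y * (\<omega> * exp (\<omega> * of_real x))) (at x)" for y \<omega> :: complex and x
    by (intro has_vector_derivative_mult_right has_vector_derivative_exp_linear)
  show "matrix_solution_on UNIV (periodic_system b d c z) u"
    unfolding u_def u_explicit_block2[abs_def] periodic_system_def[abs_def]
  proof (rule matrix_solution_on_block2_mat; rule has_vector_derivative_eq_rhs[OF exp'])
    fix x
    show "k * (- \<i> * b) * (\<i> * (of_real c + \<zeta>) * exp (\<i> * (of_real c + \<zeta>) * of_real x)) =
         \<i> * z * (k * (- \<i> * b) * exp (\<i> * (of_real c + \<zeta>) * of_real x)) +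
         b * exp (2 * \<i> * of_real c * of_real x) *
         (k * (\<zeta> - (z - of_real c)) * exp (\<i> * (\<zeta> - of_real c) * of_real x))"
      unfolding e(1)[symmetric] by (simp add: algebra_simps)
    show "k * (- \<i> * b) * (\<i> * (of_real c - \<zeta>) * exp (\<i> * (of_real c - \<zeta>) * of_real x)) =
         \<i> * z * (k * (- \<i> * b) * exp (\<i> * (of_real c - \<zeta>) * of_real x)) +
         b * exp (2 * \<i> * of_real c * of_real x) *
         (k * (- \<zeta> - (z - of_real c)) * exp (\<i> * (- \<zeta> - of_real c) * of_real x))"
      using e(1)[of x "- \<zeta>"] by (simp add: algebra_simps)
    have "\<i> * (\<zeta> - of_real c) * (\<zeta> - (z - of_real c)) = - (\<i> * (b * d)) - \<i> * z * (\<zeta> - (z - of_real c))"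
      unfolding bd by (simp add: algebra_simps power2_eq_square)
    then show "k * (\<zeta> - (z - of_real c)) * (\<i> * (\<zeta> - of_real c) * exp (\<i> * (\<zeta> - of_real c) * of_real x)) =
         d * exp (- (2 * \<i> * of_real c * of_real x)) *
         (k * (- \<i> * b) * exp (\<i> * (of_real c + \<zeta>) * of_real x)) +
         - (\<i> * z) * (k * (\<zeta> - (z - of_real c)) * exp (\<i> * (\<zeta> - of_real c) * of_real x))"
      unfolding e(2)[symmetric] by algebra
    have "\<i> * (- \<zeta> - of_real c) * (- \<zeta> - (z - of_real c)) =
        - (\<i> * (b * d)) - \<i> * z * (- \<zeta> - (z - of_real c))"
      unfolding bd by (simp add: algebra_simps power2_eq_square)
    moreover have "exp (\<i> * (- \<zeta> - of_real c) * of_real x) =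
        exp (- (2 * \<i> * of_real c * of_real x)) * exp (\<i> * (of_real c - \<zeta>) * of_real x)"
      using e(2)[of x "- \<zeta>"] by simp
    ultimately show "k * (- \<zeta> - (z - of_real c)) * (\<i> * (- \<zeta> - of_real c) * exp (\<i> * (- \<zeta> - of_real c) * of_real x)) =
         d * exp (- (2 * \<i> * of_real c * of_real x)) *
         (k * (- \<i> * b) * exp (\<i> * (of_real c - \<zeta>) * of_real x)) +
         - (\<i> * z) * (k * (- \<zeta> - (z - of_real c)) * exp (\<i> * (- \<zeta> - of_real c) * of_real x))"
      by algebra
  qed
  show "invertible (u x)" if "k \<noteq> 0" "b \<noteq> 0" "\<zeta> \<noteq> 0"
  proof -
    \<comment> \<open>The exponentials in each diagonal product cancel, so the determinant does not
      depend on \<open>x\<close>; it is proportional to \<zeta>, which is why \<zeta> must be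
      nonzero.\<close>
    have "exp (\<i> * (of_real c + \<zeta>) * of_real x) * exp (\<i> * (- \<zeta> - of_real c) * of_real x) = 1"
      "exp (\<i> * (of_real c - \<zeta>) * of_real x) * exp (\<i> * (\<zeta> - of_real c) * of_real x) = 1"
      by (simp_all add: algebra_simps flip: exp_add)
    then have "k * (- \<i> * b) * exp (\<i> * (of_real c + \<zeta>) * of_real x) *
        (k * (- \<zeta> - (z - of_real c)) * exp (\<i> * (- \<zeta> - of_real c) * of_real x)) -
      k * (- \<i> * b) * exp (\<i> * (of_real c - \<zeta>) * of_real x) *
        (k * (\<zeta> - (z - of_real c)) * exp (\<i> * (\<zeta> - of_real c) * of_real x)) = 2 * \<i> * k\<^sup>2 * b * \<zeta>"
      by algebra
    with that show ?thesis
      unfolding u_def u_explicit_block2 by (intro invertible_block2_mat) simp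
  qed
qed

text \<open>A nonzero root \<zeta> gives the explicit solution. At a vanishing root its two block
  columns coincide, and a solution that is linear in \<open>x\<close> up to the gauge factor takes
  its place.\<close>

lemma periodic_system_fundamental:
  fixes b d z :: complex and c :: real
  assumes "b \<noteq> 0"
  shows "\<exists>u. fundamental_solution_on UNIV (periodic_system b d c z) u"
proof -
  define \<zeta>0 where "\<zeta>0 = z - of_real c"
  define \<zeta> where "\<zeta> = csqrt (\<zeta>0^2 - b * d)"
  show ?thesis
  proof (cases "\<zeta> = 0")
    case False
    have "\<zeta>^2 = (z - of_real c)^2 - b * d" by (simp add: \<zeta>_def \<zeta>0_def)
    from periodic_system_solution[OF this, where k = 1] False assms show ?thesis
      by (auto simp: fundamental_solution_on_def)
  next
    case True
    \<comment> \<open>After the gauge transformation \<open>exp (\<i> c x j)\<close> the system has a constant coefficient matrix \<open>M\<close>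
      with \<open>M\<^sup>2 = - \<zeta>\<^sup>2 = 0\<close>, so that \<open>exp (x M) = 1 + x M\<close>.\<close>
    then have bd: "b * d = \<zeta>0^2" by (simp add: \<zeta>_def)
    define e where "e = (\<lambda>s x :: real. exp ((s * \<i> * of_real c) * of_real x))"
    have e': "((\<lambda>x. e s x * (\<alpha> + of_real x * \<beta>)) has_vector_derivative
        e s x * (s * \<i> * of_real c * (\<alpha> + of_real x * \<beta>) + \<beta>)) (at x)" for s x \<alpha> \<beta>
      unfolding e_def by (rule has_vector_derivative_eq_rhs,
        rule has_vector_derivative_mult[OF has_vector_derivative_exp_linear
          has_vector_derivative_add[OF has_vector_derivative_const
            has_vector_derivative_mult_left[OF has_vector_derivative_of_real[OF DERIV_ident]]]])
        (simp add: algebra_simps)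
    have ee: "e 2 x * e (- 1) x = e 1 x" "e (- 2) x * e 1 x = e (- 1) x" "e 1 x * e (- 1) x = 1" for x
      by (simp_all add: e_def algebra_simps flip: exp_add)
    have F: "periodic_system b d c z = (\<lambda>x.
        block2 (mat (\<i> * z)) (mat (b * e 2 x)) (mat (d * e (- 2) x)) (mat (- (\<i> * z))))"
      by (simp add: periodic_system_def e_def fun_eq_iff)
    \<comment> \<open>This is the gauge factor times \<open>1 + x M\<close>, with
      \<open>\<i> * \<zeta>0\<close> and \<open>- \<i> * \<zeta>0\<close> on the diagonal of
      \<open>M\<close> and \<open>b\<close>, \<open>d\<close> off it. The summands 0 keep every
      entry in the shape that \<open>e'\<close> differentiates.\<close>
    define u :: "real \<Rightarrow> complex^('a + 'a)^('a + 'a)" where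
      "u = (\<lambda>x. block2 (mat (e 1 x * (1 + of_real x * (\<i> * \<zeta>0)))) (mat (e 1 x * (0 + of_real x * b)))
        (mat (e (- 1) x * (0 + of_real x * d))) (mat (e (- 1) x * (1 + of_real x * (- \<i> * \<zeta>0)))))"
    have z: "z = \<zeta>0 + of_real c" by (simp add: \<zeta>0_def)
    have i2: "\<i> * \<i> = - 1" by simp
    have "matrix_solution_on UNIV (periodic_system b d c z) u"
      unfolding F u_def
    proof (rule matrix_solution_on_block2_mat; rule has_vector_derivative_eq_rhs[OF e'])
      fix x
      have "b * e 2 x * (e (- 1) x * (0 + of_real x * d)) = (b * d) * of_real x * (e 2 x * e (- 1) x)"
        by (simp add: algebra_simps)
      then show "e 1 x * (1 * \<i> * of_real c * (1 + of_real x * (\<i> * \<zeta>0)) + \<i> * \<zeta>0) =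
         \<i> * z * (e 1 x * (1 + of_real x * (\<i> * \<zeta>0))) + b * e 2 x * (e (- 1) x * (0 + of_real x * d))"
        unfolding ee bd z by (auto simp: algebra_simps power2_eq_square)
      have "b * e 2 x * (e (- 1) x * (1 + of_real x * (- \<i> * \<zeta>0))) =
          b * (1 + of_real x * (- \<i> * \<zeta>0)) * (e 2 x * e (- 1) x)"
        by (simp add: algebra_simps)
      then show "e 1 x * (1 * \<i> * of_real c * (0 + of_real x * b) + b) =
         \<i> * z * (e 1 x * (0 + of_real x * b)) + b * e 2 x * (e (- 1) x * (1 + of_real x * (- \<i> * \<zeta>0)))"
        unfolding ee bd z by (auto simp: algebra_simps power2_eq_square)
      have "d * e (- 2) x * (e 1 x * (1 + of_real x * (\<i> * \<zeta>0))) =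
          d * (1 + of_real x * (\<i> * \<zeta>0)) * (e (- 2) x * e 1 x)"
        by (simp add: algebra_simps)
      then show "e (- 1) x * (- 1 * \<i> * of_real c * (0 + of_real x * d) + d) =
         d * e (- 2) x * (e 1 x * (1 + of_real x * (\<i> * \<zeta>0))) + - (\<i> * z) * (e (- 1) x * (0 + of_real x * d))"
        unfolding ee bd z by (auto simp: algebra_simps power2_eq_square)
      have "d * e (- 2) x * (e 1 x * (0 + of_real x * b)) = (b * d) * of_real x * (e (- 2) x * e 1 x)"
        by (simp add: algebra_simps)
      then show "e (- 1) x * (- 1 * \<i> * of_real c * (1 + of_real x * (- \<i> * \<zeta>0)) + - \<i> * \<zeta>0) =
         d * e (- 2) x * (e 1 x * (0 + of_real x * b)) + - (\<i> * z) * (e (- 1) x * (1 + of_real x * (- \<i> * \<zeta>0)))"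
        unfolding ee bd z by (auto simp: algebra_simps power2_eq_square)
    qed
    moreover have "invertible (u x)" for x
    proof -
      \<comment> \<open>The determinant is 1 because \<open>M\<close> has trace zero and determinant
        \<open>\<zeta>0^2 - b * d = 0\<close> as a 2 by 2 matrix.\<close>
      have "e 1 x * (1 + of_real x * (\<i> * \<zeta>0)) * (e (- 1) x * (1 + of_real x * (- \<i> * \<zeta>0))) -
        e 1 x * (0 + of_real x * b) * (e (- 1) x * (0 + of_real x * d)) = 1"
        using ee(3)[of x] bd i2 by algebra
      then show ?thesis unfolding u_def by (intro invertible_block2_mat) simp
    qed
    ultimately show ?thesis by (auto simp: fundamental_solution_on_def)
  qed
qed


subsection \<open>Dirac systems\<close>

lemma sa_dirac_eq: "sa_dirac v z x = (\<i> * z) *\<^sub>C jmat + block2 0 (\<i> *\<^sub>C v x) (- (\<i> *\<^sub>C ctrans (v x))) 0"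
  unfolding sa_dirac_def jmat_Vmat
  by (simp add: cscale_algebra block2_algebra)

lemma ssa_dirac_eq: "ssa_dirac v z x = (\<i> * z) *\<^sub>C jmat + block2 0 (v x) (- ctrans (v x)) 0"
  unfolding ssa_dirac_def jmat_Vmat ..

lemma periodic_system_eq:
  "periodic_system b d c z x = (\<i> * z) *\<^sub>C jmat +
    block2 0 (mat (b * exp (2 * \<i> * of_real c * of_real x)))
      (mat (d * exp (- (2 * \<i> * of_real c * of_real x)))) 0"
  unfolding periodic_system_def jmat_eq block2_algebra mat_algebra(1)
  by (simp add: mat_algebra)

lemma cnj_exp_periodic:
  "cnj (exp (2 * \<i> * of_real c * of_real x)) = exp (- (2 * \<i> * of_real c * of_real x))"
  by (simp add: exp_cnj)

lemma dirac_periodic_system: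
  "sa_dirac (\<lambda>x. mat (a * exp (2 * \<i> * of_real c * of_real x))) =
    periodic_system (\<i> * a) (- (\<i> * cnj a)) c"
  "ssa_dirac (\<lambda>x. mat (a * exp (2 * \<i> * of_real c * of_real x))) =
    periodic_system a (- cnj a) c"
  by (simp_all add: fun_eq_iff sa_dirac_eq ssa_dirac_eq periodic_system_eq mat_algebra
      ctrans_algebra cnj_exp_periodic mult.assoc [of \<i> a] mult.assoc [of \<i> "cnj a"])

lemma sa_initial_system:
  fixes v :: "real \<Rightarrow> complex^'p^'p"
  assumes "a \<noteq> 0" and v: "v = (\<lambda>x. mat (a * exp (2 * \<i> * of_real c * of_real x)))"
  shows "\<exists>u. fundamental_solution_on UNIV (sa_dirac v z) u"
    and "\<zeta>^2 = (z - of_real c)^2 - of_real ((cmod a)^2) \<Longrightarrow>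
      matrix_solution_on UNIV (sa_dirac v z) (u_explicit c \<zeta> (Z_sa a c z \<zeta>)) \<and>
      (\<zeta> \<noteq> 0 \<longrightarrow> fundamental_solution_on UNIV (sa_dirac v z) (u_explicit c \<zeta> (Z_sa a c z \<zeta>)))"
proof -
  show "\<exists>u. fundamental_solution_on UNIV (sa_dirac v z) u"
    unfolding v dirac_periodic_system using assms by (intro periodic_system_fundamental) simp
  assume \<zeta>: "\<zeta>^2 = (z - of_real c)^2 - of_real ((cmod a)^2)"
  have \<zeta>': "\<zeta>^2 = (z - of_real c)^2 - (\<i> * a) * (- (\<i> * cnj a))"
    unfolding \<zeta> complex_norm_square by (simp add: algebra_simps)
  have Z: "Z_sa a c z \<zeta> = block2 (mat (1 * (- \<i> * (\<i> * a)))) (mat (1 * (- \<i> * (\<i> * a))))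
    (mat (1 * (\<zeta> - (z - of_real c)))) (mat (1 * (- \<zeta> - (z - of_real c))))"
    by (simp add: Z_sa_def algebra_simps)
  show "matrix_solution_on UNIV (sa_dirac v z) (u_explicit c \<zeta> (Z_sa a c z \<zeta>)) \<and>
      (\<zeta> \<noteq> 0 \<longrightarrow> fundamental_solution_on UNIV (sa_dirac v z) (u_explicit c \<zeta> (Z_sa a c z \<zeta>)))"
    unfolding v dirac_periodic_system fundamental_solution_on_def Z
    using periodic_system_solution[OF \<zeta>', where k = 1] assms by auto
qed

lemma ssa_initial_system:
  fixes v :: "real \<Rightarrow> complex^'p^'p"
  assumes "a \<noteq> 0" and v: "v = (\<lambda>x. mat (a * exp (2 * \<i> * of_real c * of_real x)))"
  shows "\<exists>u. fundamental_solution_on UNIV (ssa_dirac v z) u"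
    and "\<zeta>^2 = (z - of_real c)^2 + of_real ((cmod a)^2) \<Longrightarrow>
      matrix_solution_on UNIV (ssa_dirac v z) (u_explicit c \<zeta> (Z_ssa a c z \<zeta>)) \<and>
      (\<zeta> \<noteq> 0 \<longrightarrow> fundamental_solution_on UNIV (ssa_dirac v z) (u_explicit c \<zeta> (Z_ssa a c z \<zeta>)))"
proof -
  show "\<exists>u. fundamental_solution_on UNIV (ssa_dirac v z) u"
    unfolding v dirac_periodic_system using assms by (intro periodic_system_fundamental) simp
  assume \<zeta>: "\<zeta>^2 = (z - of_real c)^2 + of_real ((cmod a)^2)"
  have \<zeta>': "\<zeta>^2 = (z - of_real c)^2 - a * (- cnj a)"
    unfolding \<zeta> complex_norm_square by (simp add: algebra_simps)
  \<comment> \<open>In this case the normalization is \<open>k = - 1\<close>: it turns the generic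
    upper entry \<open>- \<i> * a\<close> into \<open>\<i> * a\<close> and reverses the signs in the
    lower row.\<close>
  have Z: "Z_ssa a c z \<zeta> = block2 (mat ((- 1) * (- \<i> * a))) (mat ((- 1) * (- \<i> * a)))
    (mat ((- 1) * (\<zeta> - (z - of_real c)))) (mat ((- 1) * (- \<zeta> - (z - of_real c))))"
    by (simp add: Z_ssa_def algebra_simps)
  show "matrix_solution_on UNIV (ssa_dirac v z) (u_explicit c \<zeta> (Z_ssa a c z \<zeta>)) \<and>
      (\<zeta> \<noteq> 0 \<longrightarrow> fundamental_solution_on UNIV (ssa_dirac v z) (u_explicit c \<zeta> (Z_ssa a c z \<zeta>)))"
    unfolding v dirac_periodic_system fundamental_solution_on_def Z
    using periodic_system_solution[OF \<zeta>', where k = "- 1"] assms by auto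
qed

text \<open>The parameter \<open>\<mu>\<close> is \<open>\<i>\<close> in the self-adjoint case and \<open>1\<close> in the skew-self-adjoint case.\<close>

lemma has_vector_derivative_Pi:
  fixes A Q :: "complex^'n^'n" and f1 f2 f3 f4 :: "complex^'p^'n" and a \<mu> :: complex and c :: real
  defines "B \<equiv> A - mat (of_real c)"
    and "P \<equiv> \<lambda>x. beside (Lam1 c Q f1 f2 x) (Lam2 c Q f3 f4 x)"
    and "e \<equiv> \<lambda>x. exp (2 * \<i> * of_real c * of_real x)"
  assumes a: "\<mu> * cnj a \<noteq> 0" and AQ: "A ** Q = Q ** A"
    and QQ: "Q ** Q = B ** B + mat (\<mu>^2 * (a * cnj a))"
    and f3: "(\<mu> * cnj a) *\<^sub>C f3 = \<i> *\<^sub>C ((Q + B) ** f1)"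
    and f4: "(\<mu> * cnj a) *\<^sub>C f4 = - (\<i> *\<^sub>C ((Q - B) ** f2))"
  shows "(P has_vector_derivative - (\<i> *\<^sub>C (A ** P x ** jmat)) -
    P x ** block2 0 (mat (\<mu> * (a * e x))) (- mat (\<mu> * cnj (a * e x))) 0) (at x)"
proof -
  have BQ: "B ** Q = Q ** B"
    by (simp add: B_def matrix_mult_ring mat_matrix_mult AQ)
  have A: "A = B + mat (of_real c)" by (simp add: B_def)
  have cancel: "M = M'" if "(\<mu> * cnj a) *\<^sub>C M = (\<mu> * cnj a) *\<^sub>C M'" for M M' :: "complex^'p^'n"
    using that a by (simp add: vec_eq_iff)
  \<comment> \<open>As \<open>Q\<close> and \<open>B\<close> commute, both products equal the
    difference of the squares, which is scalar. Multiplying the defining relation of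
    \<open>f3\<close> by \<open>Q - B\<close>, and that of \<open>f4\<close> by
    \<open>Q + B\<close>, therefore recovers \<open>f1\<close> and \<open>f2\<close>.\<close>
  have prod: "(Q + B) ** (Q - B) = mat (\<mu>^2 * (a * cnj a))" "(Q - B) ** (Q + B) = mat (\<mu>^2 * (a * cnj a))"
    by (simp_all add: matrix_mult_ring QQ BQ)
  have "(\<i> *\<^sub>C (Q - B)) ** ((\<mu> * cnj a) *\<^sub>C f3) = - ((\<mu> * cnj a) *\<^sub>C (\<mu> * a) *\<^sub>C f1)"
    unfolding f3 matrix_mult_cscale matrix_mul_assoc prod mat_matrix_mult
    by (simp add: cscale_algebra power2_eq_square mult_ac)
  then have f3': "\<i> *\<^sub>C ((Q - B) ** f3) = - ((\<mu> * a) *\<^sub>C f1)"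
    by - (rule cancel, simp add: matrix_mult_cscale cscale_algebra(3,7) mult_ac)
  have "(\<i> *\<^sub>C (Q + B)) ** ((\<mu> * cnj a) *\<^sub>C f4) = (\<mu> * cnj a) *\<^sub>C (\<mu> * a) *\<^sub>C f2"
    unfolding f4 matrix_mult_ring(6) matrix_mult_cscale matrix_mul_assoc prod mat_matrix_mult
    by (simp add: cscale_algebra power2_eq_square mult_ac)
  then have f4': "\<i> *\<^sub>C ((Q + B) ** f4) = (\<mu> * a) *\<^sub>C f2"
    by - (rule cancel, simp add: matrix_mult_cscale cscale_algebra(3,7) mult_ac)
  have L1: "Lam1 c Q f1 f2 = (\<lambda>x. exp ((- \<i> * of_real c) * of_real x) *\<^sub>C
      (mexp ((\<i> * of_real x) *\<^sub>C Q) ** f1 + mexp ((- \<i> * of_real x) *\<^sub>C Q) ** f2))"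
    by (simp add: Lam1_def fun_eq_iff)
  have L2: "Lam2 c Q f3 f4 = (\<lambda>x. exp ((\<i> * of_real c) * of_real x) *\<^sub>C
      (mexp ((\<i> * of_real x) *\<^sub>C Q) ** f3 + mexp ((- \<i> * of_real x) *\<^sub>C Q) ** f4))"
    by (simp add: Lam2_def fun_eq_iff)
  \<comment> \<open>The derivative of \<open>Lam1\<close> uses the definitions of \<open>f3\<close>
    and \<open>f4\<close>; that of \<open>Lam2\<close> below uses the recovered relations
    \<open>f3'\<close> and \<open>f4'\<close>. Together they form the two columns of the equation
    for \<open>P\<close>.\<close>
  have "(Lam1 c Q f1 f2 has_vector_derivative (- \<i>) *\<^sub>C (A ** Lam1 c Q f1 f2 x) +
      (\<mu> * cnj a * exp ((- \<i> * of_real c - \<i> * of_real c) * of_real x)) *\<^sub>C Lam2 c Q f3 f4 x) (at x)"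
    unfolding L1 L2
  proof (rule has_vector_derivative_Lam[OF AQ])
    show "(- \<i> * of_real c) *\<^sub>C f1 + \<i> *\<^sub>C (Q ** f1) = - \<i> *\<^sub>C (A ** f1) + (\<mu> * cnj a) *\<^sub>C f3"
      unfolding f3 A by (simp add: matrix_mult_ring mat_matrix_mult cscale_algebra)
    show "(- \<i> * of_real c) *\<^sub>C f2 - \<i> *\<^sub>C (Q ** f2) = - \<i> *\<^sub>C (A ** f2) + (\<mu> * cnj a) *\<^sub>C f4"
      unfolding f4 A by (simp add: matrix_mult_ring mat_matrix_mult cscale_algebra)
  qed
  moreover have "(Lam2 c Q f3 f4 has_vector_derivative \<i> *\<^sub>C (A ** Lam2 c Q f3 f4 x) +
      (- (\<mu> * a) * exp ((\<i> * of_real c - (- \<i> * of_real c)) * of_real x)) *\<^sub>C Lam1 c Q f1 f2 x) (at x)"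
    unfolding L1 L2
  proof (rule has_vector_derivative_Lam[OF AQ])
    show "(\<i> * of_real c) *\<^sub>C f3 + \<i> *\<^sub>C (Q ** f3) = \<i> *\<^sub>C (A ** f3) + (- (\<mu> * a)) *\<^sub>C f1"
      using f3' unfolding A by (simp add: matrix_mult_ring mat_matrix_mult cscale_algebra algebra_simps)
    show "(\<i> * of_real c) *\<^sub>C f4 - \<i> *\<^sub>C (Q ** f4) = \<i> *\<^sub>C (A ** f4) + (- (\<mu> * a)) *\<^sub>C f2"
      unfolding A cscale_algebra(6) f4'[symmetric]
      by (simp add: matrix_mult_ring mat_matrix_mult cscale_algebra algebra_simps)
  qed
  ultimately have "(P has_vector_derivative
     beside
       ((- \<i>) *\<^sub>C (A ** Lam1 c Q f1 f2 x) +
         (\<mu> * cnj a * exp ((- \<i> * of_real c - \<i> * of_real c) * of_real x)) *\<^sub>C Lam2 c Q f3 f4 x)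
       (\<i> *\<^sub>C (A ** Lam2 c Q f3 f4 x) +
         (- (\<mu> * a) * exp ((\<i> * of_real c - (- \<i> * of_real c)) * of_real x)) *\<^sub>C Lam1 c Q f1 f2 x))
     (at x)"
    unfolding P_def by (rule has_vector_derivative_beside)
  also have "exp ((- \<i> * of_real c - \<i> * of_real c) * of_real x) = cnj (e x)"
    unfolding e_def cnj_exp_periodic by (simp add: algebra_simps)
  also have "exp ((\<i> * of_real c - (- \<i> * of_real c)) * of_real x) = e x"
    unfolding e_def by (simp add: algebra_simps)
  finally show ?thesis
    unfolding P_def jmat_def beside_algebra
    by (simp add: matrix_mult_ring mat_matrix_mult cscale_algebra mult.assoc)
qed

section \<open>Transformed potentials\<close>

text \<open>With \<open>jmat\<close> squared equal to 1, the added term is \<open>X - j X j\<close>: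
  the diagonal blocks cancel and the others double. Matching the upper block with \<i> times the new
  potential gives the factor \<open>- 2 * \<i>\<close>; the lower block then agrees by the adjoint
  relation between \<open>X12\<close> and \<open>X21\<close>.\<close>

lemma sa_transformed_system:
  fixes X11 X12 X21 X22 :: "complex^'p^'p"
  assumes "ctrans X12 = X21" "vt x = v x - (2 * \<i>) *\<^sub>C X12"
  shows "sa_dirac vt z x = sa_dirac v z x +
    (jmat ** jmat ** block2 X11 X12 X21 X22 - jmat ** block2 X11 X12 X21 X22 ** jmat)"
  unfolding sa_dirac_eq unfolding jmat_simps jmat_def matrix_mul_lid block2_algebra
  using assms
  by (simp add: matrix_mult_ring cscale_algebra ctrans_algebra)
    (rule block2_eqI; simp add: algebra_simps)

text \<open>Now the added term is the commutator of \<open>jmat\<close> with \<open>X\<close>. Its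
  off-diagonal blocks are \<open>2 X12\<close> and \<open>- 2 X21\<close>, which is the shape of
  \<open>jmat\<close> times a potential matrix.\<close>

lemma ssa_transformed_system:
  fixes X11 X12 X21 X22 :: "complex^'p^'p"
  assumes "ctrans X12 = X21" "vt x = v x + 2 *\<^sub>C X12"
  shows "ssa_dirac vt z x = ssa_dirac v z x +
    (jmat ** mat 1 ** block2 X11 X12 X21 X22 - mat 1 ** block2 X11 X12 X21 X22 ** jmat)"
  unfolding ssa_dirac_eq unfolding jmat_def matrix_mul_lid matrix_mul_rid block2_algebra
  using assms
  by (simp add: matrix_mult_ring cscale_algebra ctrans_algebra)
    (rule block2_eqI; simp add: algebra_simps)

lemma interval_integral_primitive:
  fixes f :: "real \<Rightarrow> 'a::euclidean_space"
  assumes "\<And>x. isCont f x"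
  shows "((\<lambda>x. C + (LBINT r=ereal 0..ereal x. f r)) has_vector_derivative f x) (at x)"
    and "C + (LBINT r=ereal 0..ereal 0. f r) = C"
proof -
  have "((\<lambda>x. LBINT r=ereal 0..ereal x. f r) has_vector_derivative f x) (at x)"
    using assms by (intro has_vector_derivative_interval_integral) (simp add: continuous_at_imp_continuous_on)
  from has_vector_derivative_add[OF has_vector_derivative_const[of C] this]
  show "((\<lambda>x. C + (LBINT r=ereal 0..ereal x. f r)) has_vector_derivative f x) (at x)"
    by simp
qed simp

lemma isCont_matrix_sandwich:
  fixes P :: "real \<Rightarrow> complex^'m^'n"
  assumes "\<And>x. (P has_vector_derivative P' x) (at x)"
  shows "isCont (\<lambda>x. P x ** K ** ctrans (P x)) x"
  by (rule has_vector_derivative_continuous has_vector_derivative_matrix_mult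
      has_vector_derivative_const has_vector_derivative_ctrans assms)+

text \<open>This supplies the adjoint relation between the off-diagonal blocks of \<open>X\<close>
  that the two preceding computations of the potential require.\<close>

lemma ctrans_corner:
  assumes "invertible M" "ctrans M = M"
  shows "ctrans (ctrans L ** matrix_inv M ** L') = ctrans L' ** matrix_inv M ** L"
  using assms by (simp add: ctrans_algebra ctrans_matrix_inv matrix_mul_assoc)

lemma matrix_solution_on_cong:
  "(\<And>x. x \<in> J \<Longrightarrow> F x = G x) \<Longrightarrow> matrix_solution_on J F = matrix_solution_on J G"
  by (simp add: matrix_solution_on_def fun_eq_iff)

lemma fundamental_solution_on_cong:
  "(\<And>x. x \<in> J \<Longrightarrow> F x = G x) \<Longrightarrow> fundamental_solution_on J F = fundamental_solution_on J G"
  unfolding fundamental_solution_on_def fun_eq_iff by (simp cong: matrix_solution_on_cong)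

section \<open>The two Dirac cases as instances of the Darboux transformation\<close>

lemma sa_darboux:
  fixes A Q S0 :: "complex^'n^'n" and f1 f2 f3 f4 :: "complex^'p^'n"
    and v :: "real \<Rightarrow> complex^'p^'p" and a :: complex and c :: real
  defines "B \<equiv> A - mat (of_real c)"
    and "P \<equiv> \<lambda>x. beside (Lam1 c Q f1 f2 x) (Lam2 c Q f3 f4 x)"
  defines "S \<equiv> S_sa S0 P"
  defines "vt \<equiv> \<lambda>x. v x - (2 * \<i>) *\<^sub>C (ctrans (Lam1 c Q f1 f2 x) ** matrix_inv (S x) ** Lam2 c Q f3 f4 x)"
  assumes a: "a \<noteq> 0" and v: "v = (\<lambda>x. mat (a * exp (2 * \<i> * of_real c * of_real x)))"
    and AQ: "A ** Q = Q ** A" and QQ: "Q ** Q = B ** B - mat (of_real ((cmod a)^2))"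
    and f3: "f3 = (1 / cnj a) *\<^sub>C ((Q + B) ** f1)"
    and f4: "f4 = - ((1 / cnj a) *\<^sub>C ((Q - B) ** f2))"
    and S0: "S0 = ctrans S0" "A ** S0 - S0 ** ctrans A = \<i> *\<^sub>C (P 0 ** jmat ** ctrans (P 0))"
    and inv: "\<forall>x\<in>J. invertible (S x)" "invertible (A - mat z)"
  shows "matrix_solution_on J (sa_dirac v z) u \<Longrightarrow>
      matrix_solution_on J (sa_dirac vt z) (\<lambda>x. w_sa A P S x z ** u x)"
    and "fundamental_solution_on J (sa_dirac v z) u \<Longrightarrow> invertible (ctrans A - mat z) \<Longrightarrow>
      fundamental_solution_on J (sa_dirac vt z) (\<lambda>x. w_sa A P S x z ** u x)"
proof -
  \<comment> \<open>This is \<open>\<i> j V\<close>, written in the form that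
    \<open>has_vector_derivative_Pi\<close> produces with \<mu> equal to \<i>; the square of \<mu>
    is -1, in accordance with the minus sign in \<open>QQ\<close>.\<close>
  define N where "N = (\<lambda>x. block2 0 (mat (\<i> * (a * exp (2 * \<i> * of_real c * of_real x))))
    (- mat (\<i> * cnj (a * exp (2 * \<i> * of_real c * of_real x)))) 0 :: complex^('p + 'p)^('p + 'p))"
  have P': "(P has_vector_derivative - (\<i> *\<^sub>C (A ** P x ** jmat)) - P x ** N x) (at x)" for x
    unfolding P_def N_def
  proof (rule has_vector_derivative_Pi)
    show "Q ** Q = (A - mat (of_real c)) ** (A - mat (of_real c)) + mat (\<i>\<^sup>2 * (a * cnj a))"
      unfolding QQ B_def complex_norm_square by (simp flip: mat_algebra(4))
  qed (use a in \<open>simp_all add: AQ f3 f4 B_def cscale_algebra\<close>)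
  \<comment> \<open>With \<open>K\<close> equal to \<open>jmat\<close> the factor
    \<open>K ** j\<close> is the identity, so the integrand has no middle factor.\<close>
  have S': "(S has_vector_derivative P x ** jmat ** jmat ** ctrans (P x)) (at x)" for x
    unfolding S_def S_sa_def
    using interval_integral_primitive(1)[OF isCont_matrix_sandwich[OF P', where K = "mat 1"]]
    by (simp add: jmat_simps flip: matrix_mul_assoc)
  have S_zero: "S 0 = S0"
    using interval_integral_primitive(2)[OF isCont_matrix_sandwich[OF P', where K = "mat 1"]]
    by (simp add: S_def S_sa_def)
  interpret darboux A jmat jmat P N S
  proof
    show "jmat ** ctrans (N x) = - (N x ** jmat)" for x
      unfolding N_def jmat_def block2_algebra
      by (simp add: ctrans_algebra block2_algebra matrix_mult_ring mat_algebra mat_matrix_mult cscale_algebra)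
  qed (use S0(1)[symmetric] S0(2) in \<open>simp_all add: jmat_simps P' S' S_zero\<close>)
  have F: "F z = sa_dirac v z" for z
    unfolding fun_eq_iff F_def by (simp add: sa_dirac_eq v N_def ctrans_algebra mat_algebra)
  have W: "(\<lambda>x. w_sa A P S x z ** u x) = (\<lambda>x. w z x ** u x)"
    by (simp add: w_sa_def w_def)
  \<comment> \<open>The coefficient is identified only on \<open>J\<close>, where \<open>S x\<close>
    is invertible and its inverse is therefore self-adjoint; hence the congruence rules restricted
    to \<open>J\<close>.\<close>
  have vt: "F z x + (jmat ** jmat ** X x - jmat ** X x ** jmat) = sa_dirac vt z x" if "x \<in> J" for x
    unfolding F X_def unfolding P_def ctrans_beside_sandwich
    using inv(1) that by (intro sa_transformed_system[symmetric] ctrans_corner ctrans_S) (auto simp: vt_def P_def)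
  show "matrix_solution_on J (sa_dirac vt z) (\<lambda>x. w_sa A P S x z ** u x)"
    if "matrix_solution_on J (sa_dirac v z) u"
    using matrix_solution[of J z u] that inv matrix_solution_on_cong[OF vt, of J]
    unfolding W F[symmetric] by simp
  show "fundamental_solution_on J (sa_dirac vt z) (\<lambda>x. w_sa A P S x z ** u x)"
    if "fundamental_solution_on J (sa_dirac v z) u" "invertible (ctrans A - mat z)"
    using fundamental_solution[of J z u] that inv fundamental_solution_on_cong[OF vt, of J]
    unfolding W F[symmetric] by simp
qed

lemma ssa_darboux:
  fixes A Q S0 :: "complex^'n^'n" and f1 f2 f3 f4 :: "complex^'p^'n"
    and v :: "real \<Rightarrow> complex^'p^'p" and a :: complex and c :: real
  defines "B \<equiv> A - mat (of_real c)"
    and "P \<equiv> \<lambda>x. beside (Lam1 c Q f1 f2 x) (Lam2 c Q f3 f4 x)"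
  defines "S \<equiv> S_ssa S0 P"
  defines "vt \<equiv> \<lambda>x. v x + 2 *\<^sub>C (ctrans (Lam1 c Q f1 f2 x) ** matrix_inv (S x) ** Lam2 c Q f3 f4 x)"
  assumes a: "a \<noteq> 0" and v: "v = (\<lambda>x. mat (a * exp (2 * \<i> * of_real c * of_real x)))"
    and AQ: "A ** Q = Q ** A" and QQ: "Q ** Q = B ** B + mat (of_real ((cmod a)^2))"
    and f3: "f3 = (\<i> / cnj a) *\<^sub>C ((Q + B) ** f1)"
    and f4: "f4 = - ((\<i> / cnj a) *\<^sub>C ((Q - B) ** f2))"
    and S0: "S0 = ctrans S0" "A ** S0 - S0 ** ctrans A = \<i> *\<^sub>C (P 0 ** ctrans (P 0))"
    and inv: "\<forall>x\<in>J. invertible (S x)" "invertible (A - mat z)"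
  shows "matrix_solution_on J (ssa_dirac v z) u \<Longrightarrow>
      matrix_solution_on J (ssa_dirac vt z) (\<lambda>x. w_ssa A P S x z ** u x)"
    and "fundamental_solution_on J (ssa_dirac v z) u \<Longrightarrow> invertible (ctrans A - mat z) \<Longrightarrow>
      fundamental_solution_on J (ssa_dirac vt z) (\<lambda>x. w_ssa A P S x z ** u x)"
proof -
  \<comment> \<open>Here \<mu> is 1 and \<open>N\<close> is \<open>j V\<close>. The trivial factors
    1 match the general form of \<open>has_vector_derivative_Pi\<close>.\<close>
  define N where "N = (\<lambda>x. block2 0 (mat (1 * (a * exp (2 * \<i> * of_real c * of_real x))))
    (- mat (1 * cnj (a * exp (2 * \<i> * of_real c * of_real x)))) 0 :: complex^('p + 'p)^('p + 'p))"
  have P': "(P has_vector_derivative - (\<i> *\<^sub>C (A ** P x ** jmat)) - P x ** N x) (at x)" for x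
    unfolding P_def N_def
  proof (rule has_vector_derivative_Pi)
    show "Q ** Q = (A - mat (of_real c)) ** (A - mat (of_real c)) + mat (1\<^sup>2 * (a * cnj a))"
      unfolding QQ B_def complex_norm_square by simp
  qed (use a in \<open>simp_all add: AQ f3 f4 B_def cscale_algebra\<close>)
  have S': "(S has_vector_derivative P x ** mat 1 ** jmat ** ctrans (P x)) (at x)" for x
    unfolding S_def S_ssa_def
    using interval_integral_primitive(1)[OF isCont_matrix_sandwich[OF P', where K = jmat]]
    by simp
  have S_zero: "S 0 = S0"
    using interval_integral_primitive(2)[OF isCont_matrix_sandwich[OF P', where K = jmat]]
    by (simp add: S_def S_ssa_def)
  interpret darboux A "mat 1" jmat P N S
  proof
    show "mat 1 ** ctrans (N x) = - (N x ** mat 1)" for x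
      unfolding N_def by (simp add: ctrans_algebra block2_algebra mat_algebra)
  qed (use S0(1)[symmetric] S0(2) in \<open>simp_all add: jmat_simps P' S'[simplified] S_zero ctrans_algebra\<close>)
  have F: "F z = ssa_dirac v z" for z
    unfolding fun_eq_iff F_def by (simp add: ssa_dirac_eq v N_def ctrans_algebra)
  have W: "(\<lambda>x. w_ssa A P S x z ** u x) = (\<lambda>x. w z x ** u x)"
    by (simp add: w_ssa_def w_def)
  have vt: "F z x + (jmat ** mat 1 ** X x - mat 1 ** X x ** jmat) = ssa_dirac vt z x" if "x \<in> J" for x
    unfolding F X_def unfolding P_def ctrans_beside_sandwich
    using inv(1) that by (intro ssa_transformed_system[symmetric] ctrans_corner ctrans_S) (auto simp: vt_def P_def)
  show "matrix_solution_on J (ssa_dirac vt z) (\<lambda>x. w_ssa A P S x z ** u x)"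
    if "matrix_solution_on J (ssa_dirac v z) u"
    using matrix_solution[of J z u] that inv matrix_solution_on_cong[OF vt, of J]
    unfolding W F[symmetric] by simp
  show "fundamental_solution_on J (ssa_dirac vt z) (\<lambda>x. w_ssa A P S x z ** u x)"
    if "fundamental_solution_on J (ssa_dirac v z) u" "invertible (ctrans A - mat z)"
    using fundamental_solution[of J z u] that inv fundamental_solution_on_cong[OF vt, of J]
    unfolding W F[symmetric] by simp
qed

text \<open>The explicit matrix always solves the initial system but is singular where \<zeta>
  vanishes, so existence of a fundamental solution is asserted separately for every
  \<open>z\<close>. Invertibility of \<open>ctrans A - mat z\<close> is what carries invertibility
  of \<open>u\<close> over to the transformed solution.\<close>

theorem theorem3p4:
  fixes a :: complex and c :: real and A :: "complex^'n^'n"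
    and v :: "real \<Rightarrow> complex^'p^'p"
  assumes "a \<noteq> 0"
    and "v = (\<lambda>x. mat (a * exp (2 * \<i> * of_real c * of_real x)))"
  shows
    "((\<forall>z.
        (\<exists>u. fundamental_solution_on UNIV (sa_dirac v z) u) \<and>
        (\<forall>\<zeta>. \<zeta>^2 = (z - of_real c)^2 - of_real ((cmod a)^2) \<longrightarrow>
          matrix_solution_on UNIV (sa_dirac v z) (u_explicit c \<zeta> (Z_sa a c z \<zeta>)) \<and>
          (\<zeta> \<noteq> 0 \<longrightarrow>
            fundamental_solution_on UNIV (sa_dirac v z) (u_explicit c \<zeta> (Z_sa a c z \<zeta>)))))
     \<and>
     (\<forall>(Q :: complex^'n^'n) (f1 :: complex^'p^'n) (f2 :: complex^'p^'n)
        (f3 :: complex^'p^'n) (f4 :: complex^'p^'n) (S0 :: complex^'n^'n).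
        let B = A - mat (of_real c);
            \<Lambda>1 = Lam1 c Q f1 f2;
            \<Lambda>2 = Lam2 c Q f3 f4;
            P = (\<lambda>x. beside (\<Lambda>1 x) (\<Lambda>2 x));
            S = S_sa S0 P;
            vt = (\<lambda>x. v x - (2 * \<i>) *\<^sub>C (ctrans (\<Lambda>1 x) ** matrix_inv (S x) ** \<Lambda>2 x))
        in
        det (B ** B - mat (of_real ((cmod a)^2))) \<noteq> 0 \<longrightarrow>
        A ** Q = Q ** A \<longrightarrow>
        Q ** Q = B ** B - mat (of_real ((cmod a)^2)) \<longrightarrow>
        f3 = (1 / cnj a) *\<^sub>C ((Q + B) ** f1) \<longrightarrow>
        f4 = - ((1 / cnj a) *\<^sub>C ((Q - B) ** f2)) \<longrightarrow>
        S0 = ctrans S0 \<longrightarrow>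
        A ** S0 - S0 ** ctrans A = \<i> *\<^sub>C (P 0 ** jmat ** ctrans (P 0)) \<longrightarrow>
        (\<forall>J z u.
          is_interval J \<longrightarrow>
          (\<forall>x\<in>J. invertible (S x)) \<longrightarrow>
          invertible (A - mat z) \<longrightarrow>
          (matrix_solution_on J (sa_dirac v z) u \<longrightarrow>
            matrix_solution_on J (sa_dirac vt z) (\<lambda>x. w_sa A P S x z ** u x)) \<and>
          (fundamental_solution_on J (sa_dirac v z) u \<and> invertible (ctrans A - mat z) \<longrightarrow>
            fundamental_solution_on J (sa_dirac vt z) (\<lambda>x. w_sa A P S x z ** u x)))))
    \<and>
    ((\<forall>z.
        (\<exists>u. fundamental_solution_on UNIV (ssa_dirac v z) u) \<and>
        (\<forall>\<zeta>. \<zeta>^2 = (z - of_real c)^2 + of_real ((cmod a)^2) \<longrightarrow>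
          matrix_solution_on UNIV (ssa_dirac v z) (u_explicit c \<zeta> (Z_ssa a c z \<zeta>)) \<and>
          (\<zeta> \<noteq> 0 \<longrightarrow>
            fundamental_solution_on UNIV (ssa_dirac v z) (u_explicit c \<zeta> (Z_ssa a c z \<zeta>)))))
     \<and>
     (\<forall>(Q :: complex^'n^'n) (f1 :: complex^'p^'n) (f2 :: complex^'p^'n)
        (f3 :: complex^'p^'n) (f4 :: complex^'p^'n) (S0 :: complex^'n^'n).
        let B = A - mat (of_real c);
            \<Lambda>1 = Lam1 c Q f1 f2;
            \<Lambda>2 = Lam2 c Q f3 f4;
            P = (\<lambda>x. beside (\<Lambda>1 x) (\<Lambda>2 x));
            S = S_ssa S0 P;
            vt = (\<lambda>x. v x + 2 *\<^sub>C (ctrans (\<Lambda>1 x) ** matrix_inv (S x) ** \<Lambda>2 x))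
        in
        det (B ** B + mat (of_real ((cmod a)^2))) \<noteq> 0 \<longrightarrow>
        A ** Q = Q ** A \<longrightarrow>
        Q ** Q = B ** B + mat (of_real ((cmod a)^2)) \<longrightarrow>
        f3 = (\<i> / cnj a) *\<^sub>C ((Q + B) ** f1) \<longrightarrow>
        f4 = - ((\<i> / cnj a) *\<^sub>C ((Q - B) ** f2)) \<longrightarrow>
        S0 = ctrans S0 \<longrightarrow>
        A ** S0 - S0 ** ctrans A = \<i> *\<^sub>C (P 0 ** ctrans (P 0)) \<longrightarrow>
        (\<forall>J z u.
          is_interval J \<longrightarrow>
          (\<forall>x\<in>J. invertible (S x)) \<longrightarrow>
          invertible (A - mat z) \<longrightarrow>
          (matrix_solution_on J (ssa_dirac v z) u \<longrightarrow>
            matrix_solution_on J (ssa_dirac vt z) (\<lambda>x. w_ssa A P S x z ** u x)) \<and>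
          (fundamental_solution_on J (ssa_dirac v z) u \<and> invertible (ctrans A - mat z) \<longrightarrow>
            fundamental_solution_on J (ssa_dirac vt z) (\<lambda>x. w_ssa A P S x z ** u x)))))"
  unfolding Let_def
  apply (intro conjI allI)
  subgoal by (rule sa_initial_system[OF assms])
  subgoal by (rule impI, rule sa_initial_system(2)[OF assms])
  subgoal for Q f1 f2 f3 f4 S0
    by (intro impI allI conjI; (elim conjE)?;
      rule sa_darboux [OF assms, where A = A and Q = Q and ?f1.0 = f1 and ?f2.0 = f2
        and ?f3.0 = f3 and ?f4.0 = f4 and ?S0.0 = S0];
      assumption)
  subgoal by (rule ssa_initial_system[OF assms])
  subgoal by (rule impI, rule ssa_initial_system(2)[OF assms])
  subgoal for Q f1 f2 f3 f4 S0
    by (intro impI allI conjI; (elim conjE)?;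
      rule ssa_darboux [OF assms, where A = A and Q = Q and ?f1.0 = f1 and ?f2.0 = f2
        and ?f3.0 = f3 and ?f4.0 = f4 and ?S0.0 = S0];
      assumption)
  done

end
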